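(* Consider a family of Dense $k$-subgraph instances $(G,k)$, $G$ an undirected simple graph on $n$ vertices, such that (with implied constants fixed over the family) $k=\Theta(n^{2/3})$, the maximum degree of $G$ is $O(n^{1/3})$, and the maximum number of edges induced by a $k$-vertex subset of $G$ is $\Theta(k\,n^{1/3})$ (i.e. an optimal $k$-subgraph has average degree $\Theta(n^{1/3})$). If the unweighted Fixed cost minimum edge cover problem admits a PTAS, then the Dense $k$-subgraph problem restricted to this family admits a polynomial-time constant-factor approximation algorithm.
   Context: Dense $k$-subgraph problem: given a graph $G$ and integer $k$, find a set of $k$ vertices maximizing the number of edges with both endpoints in the set. Unweighted Fixed cost minimum edge cover problem: given a graph $G=(V,E)$ and integer $k$, find $U\subseteq V$ with $|U|\ge k$ minimizing $t(U)$, the number of edges with at least one endpoint in $U$. A PTAS is a family of polynomial-time algorithms achieving approximation ratio $1+\varepsilon$ for every constant $\varepsilon>0$. *)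

theory Defs
  imports
    Complex_Main
    "HOL-Computational_Algebra.Polynomial"
    "HOL-Library.Landau_Symbols"
begin

section \<open>Polynomial time\<close>

text \<open>
  The libraries provide no machine model.  We use structured programs over finitely many registers,
  each of which is a stack of bits.  Every elementary instruction and every test costs one time
  unit.  A stack is a one-way infinite Turing tape with its head at the top, and two stacks hold one
  two-way infinite tape, so these programs and multi-tape Turing machines simulate each other with
  constant-factor overhead; ``polynomial time'' is therefore the usual notion.
\<close>

type_synonym state = "nat \<Rightarrow> bool list"

datatype test = Nonempty nat | TopTrue nat

datatype prog =
    Skip
  | Push nat bool
  | Pop nat
  | Seq prog prog
  | IfThenElse test prog prog
  | While test prog

fun holds :: "test \<Rightarrow> state \<Rightarrow> bool" where
  "holds (Nonempty r) s \<longleftrightarrow> s r \<noteq> []"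
| "holds (TopTrue r) s \<longleftrightarrow> s r \<noteq> [] \<and> hd (s r)"

text \<open>\<open>runs c s t s'\<close>: started in \<open>s\<close>, the program \<open>c\<close> halts in \<open>s'\<close> after exactly \<open>t\<close> time units.\<close>

inductive runs :: "prog \<Rightarrow> state \<Rightarrow> nat \<Rightarrow> state \<Rightarrow> bool" where
  Skip: "runs Skip s 1 s"
| Push: "runs (Push r b) s 1 (s(r := b # s r))"
| Pop: "runs (Pop r) s 1 (s(r := tl (s r)))"
| Seq: "runs c1 s t1 s' \<Longrightarrow> runs c2 s' t2 s'' \<Longrightarrow> runs (Seq c1 c2) s (t1 + t2) s''"
| IfTrue: "holds b s \<Longrightarrow> runs c1 s t s' \<Longrightarrow> runs (IfThenElse b c1 c2) s (Suc t) s'"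
| IfFalse: "\<not> holds b s \<Longrightarrow> runs c2 s t s' \<Longrightarrow> runs (IfThenElse b c1 c2) s (Suc t) s'"
| WhileFalse: "\<not> holds b s \<Longrightarrow> runs (While b c) s 1 s"
| WhileTrue: "holds b s \<Longrightarrow> runs c s t1 s' \<Longrightarrow> runs (While b c) s' t2 s'' \<Longrightarrow>
    runs (While b c) s (Suc (t1 + t2)) s''"

lemma runs_deterministic:
  "runs c s t s' \<Longrightarrow> runs c s u s'' \<Longrightarrow> u = t \<and> s'' = s'"
proof (induction arbitrary: u s'' rule: runs.induct)
  case (Skip s)
  then show ?case by cases simp
next
  case (Push r b s)
  then show ?case by cases simp
next
  case (Pop r s)
  then show ?case by cases simp
next
  case (Seq c1 s t1 s1 c2 t2 s2)
  from Seq.prems show ?case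
    by cases (use Seq.IH in blast)
next
  case (IfTrue b s c1 t s1 c2)
  from IfTrue.prems show ?case
    by cases (use IfTrue.hyps IfTrue.IH in blast)+
next
  case (IfFalse b s c2 t s1 c1)
  from IfFalse.prems show ?case
    by cases (use IfFalse.hyps IfFalse.IH in blast)+
next
  case (WhileFalse b s c)
  from WhileFalse.prems show ?case
    by cases (use WhileFalse.hyps in blast)+
next
  case (WhileTrue b s c t1 s1 t2 s2)
  from WhileTrue.prems show ?case
    by cases (use WhileTrue.hyps WhileTrue.IH in blast)+
qed

text \<open>The input is placed in register 0, all other registers being empty; the output is read from
  register 0.\<close>

definition initial :: "bool list \<Rightarrow> state" where
  "initial x = (\<lambda>r. if r = 0 then x else [])"

text \<open>The running time is measured against the length of the encoded input.  Nothing is demanded of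
  the program on inputs outside \<open>I\<close>.\<close>

definition solves_in_poly_time ::
  "('i \<Rightarrow> bool list) \<Rightarrow> prog \<Rightarrow> 'i set \<Rightarrow> ('i \<Rightarrow> bool list \<Rightarrow> bool) \<Rightarrow> bool" where
  "solves_in_poly_time enc c I ok \<longleftrightarrow>
     (\<exists>p :: nat poly. \<forall>i\<in>I. \<exists>t s. runs c (initial (enc i)) t s \<and>
        t \<le> poly p (length (enc i)) \<and> ok i (s 0))"


section \<open>Graphs and their encoding\<close>

text \<open>An instance \<open>(n, E, k)\<close> of either problem is a simple undirected graph with vertex set
  \<open>{..<n}\<close> and edges given as two-element sets, together with a bound \<open>k \<le> n\<close> (for \<open>k > n\<close> there is
  no feasible solution).\<close>

type_synonym inst = "nat \<times> nat set set \<times> nat"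

definition simple_graph :: "nat \<Rightarrow> nat set set \<Rightarrow> bool" where
  "simple_graph n E \<longleftrightarrow> (\<forall>e\<in>E. e \<subseteq> {..<n} \<and> card e = 2)"

definition instances :: "inst set" where
  "instances = {(n, E, k). simple_graph n E \<and> k \<le> n}"

definition vertex_degree :: "nat set set \<Rightarrow> nat \<Rightarrow> nat" where
  "vertex_degree E v = card {e \<in> E. v \<in> e}"

text \<open>The element \<open>0\<close> only matters for the graph without vertices.\<close>

definition max_degree :: "nat \<Rightarrow> nat set set \<Rightarrow> nat" where
  "max_degree n E = Max (insert 0 (vertex_degree E ` {..<n}))"

text \<open>The code of \<open>(n, E, k)\<close> is \<open>n\<close> and \<open>k\<close> in unary followed by the adjacency matrix, row by row.
  A set of vertices is output as its characteristic vector of length \<open>n\<close>.\<close>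

definition encode :: "inst \<Rightarrow> bool list" where
  "encode = (\<lambda>(n, E, k). replicate n True @ [False] @ replicate k True @ [False] @
     concat (map (\<lambda>i. map (\<lambda>j. {i, j} \<in> E) [0..<n]) [0..<n]))"

definition decode_set :: "bool list \<Rightarrow> nat set" where
  "decode_set y = {v. v < length y \<and> y ! v}"


section \<open>The two optimization problems\<close>

definition edges_inside :: "nat set set \<Rightarrow> nat set \<Rightarrow> nat" where
  "edges_inside E U = card {e \<in> E. e \<subseteq> U}"

definition edges_touching :: "nat set set \<Rightarrow> nat set \<Rightarrow> nat" where
  "edges_touching E U = card {e \<in> E. e \<inter> U \<noteq> {}}"

definition dks_opt :: "inst \<Rightarrow> nat" where
  "dks_opt = (\<lambda>(n, E, k). Max {edges_inside E U | U. U \<subseteq> {..<n} \<and> card U = k})"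

definition fcec_opt :: "inst \<Rightarrow> nat" where
  "fcec_opt = (\<lambda>(n, E, k). Min {edges_touching E U | U. U \<subseteq> {..<n} \<and> k \<le> card U})"

definition dks_approx :: "real \<Rightarrow> inst \<Rightarrow> bool list \<Rightarrow> bool" where
  "dks_approx \<rho> = (\<lambda>(n, E, k) y. length y = n \<and> card (decode_set y) = k \<and>
     real (dks_opt (n, E, k)) \<le> \<rho> * real (edges_inside E (decode_set y)))"

definition fcec_approx :: "real \<Rightarrow> inst \<Rightarrow> bool list \<Rightarrow> bool" where
  "fcec_approx \<rho> = (\<lambda>(n, E, k) y. length y = n \<and> k \<le> card (decode_set y) \<and>
     real (edges_touching E (decode_set y)) \<le> \<rho> * real (fcec_opt (n, E, k)))"

definition fcec_has_ptas :: bool where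
  "fcec_has_ptas \<longleftrightarrow>
     (\<forall>\<epsilon>>0. \<exists>c. solves_in_poly_time encode c instances (fcec_approx (1 + \<epsilon>)))"

definition dks_has_const_approx_on :: "inst set \<Rightarrow> bool" where
  "dks_has_const_approx_on F \<longleftrightarrow>
     (\<exists>\<rho>\<ge>1. \<exists>c. solves_in_poly_time encode c F (dks_approx \<rho>))"


section \<open>The family of instances\<close>

text \<open>Over the filter \<open>principal F\<close>, the Landau symbols assert bounds that hold for every member
  of \<open>F\<close>, with constants depending only on \<open>F\<close>.\<close>

definition dks_family :: "inst set \<Rightarrow> bool" where
  "dks_family F \<longleftrightarrow> F \<subseteq> instances \<and>
     (\<lambda>(n, E, k). real k) \<in> \<Theta>[principal F](\<lambda>(n, E, k). real n powr (2/3)) \<and>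
     (\<lambda>(n, E, k). real (max_degree n E)) \<in> O[principal F](\<lambda>(n, E, k). real n powr (1/3)) \<and>
     (\<lambda>(n, E, k). real (dks_opt (n, E, k)))
       \<in> \<Theta>[principal F](\<lambda>(n, E, k). real k * real n powr (1/3))"

end

theory Submission
  imports Defs
begin

text \<open>
  Add \<open>n * n\<close> pad vertices forming a clique and join each vertex \<open>i\<close> of \<open>G\<close> to \<open>D - deg i\<close> pad vertices
  of its own, \<open>D\<close> being the maximum degree. In the new graph a set \<open>U\<close> of old vertices touches exactly
  \<open>D * card U - e(U)\<close> edges, where \<open>e(U)\<close> is the number of edges of \<open>G\<close> inside \<open>U\<close>, so for \<open>card U = k\<close>
  minimizing the cover means maximizing \<open>e(U)\<close>. In the family the optimum \<open>e(U)\<close> is a constant fraction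
  of \<open>D * k\<close>; hence a cover within a factor \<open>1 + \<epsilon>\<close> of optimal, for a small constant \<open>\<epsilon>\<close>, is cheaper than
  any set containing a pad vertex and induces at least half of the optimal number of edges.
\<close>

section \<open>Programs with bounded loops\<close>

text \<open>Here \<open>m\<close> bounds the number of iterations of each loop. Once such an \<open>m\<close> is known to be polynomial,
  so is the running time, and no further time accounting is needed.\<close>

fun time_bound :: "prog \<Rightarrow> nat \<Rightarrow> nat" where
  "time_bound Skip m = 1"
| "time_bound (Push r b) m = 1"
| "time_bound (Pop r) m = 1"
| "time_bound (Seq c1 c2) m = time_bound c1 m + time_bound c2 m"
| "time_bound (IfThenElse b c1 c2) m = Suc (time_bound c1 m + time_bound c2 m)"
| "time_bound (While b c) m = Suc (m * Suc (time_bound c m))"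

lemma poly_nat_mono: "x \<le> y \<Longrightarrow> poly p x \<le> poly p (y::nat)"
  by (induction p) (auto intro!: mult_le_mono)

lemma time_bound_poly: "\<exists>p :: nat poly. \<forall>m. time_bound c m = poly p m"
proof (induction c)
  case Skip
  show ?case by (rule exI[of _ 1]) simp
next
  case (Push r b)
  show ?case by (rule exI[of _ 1]) simp
next
  case (Pop r)
  show ?case by (rule exI[of _ 1]) simp
next
  case (Seq c1 c2)
  then obtain p q where "\<forall>m. time_bound c1 m = poly p m" "\<forall>m. time_bound c2 m = poly q m" by auto
  then show ?case by (intro exI[of _ "p + q"]) simp
next
  case (IfThenElse b c1 c2)
  then obtain p q where "\<forall>m. time_bound c1 m = poly p m" "\<forall>m. time_bound c2 m = poly q m" by auto
  then show ?case by (intro exI[of _ "1 + p + q"]) simp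
next
  case (While b c)
  then obtain p where "\<forall>m. time_bound c m = poly p m" by auto
  then show ?case by (intro exI[of _ "1 + [:0, 1:] * (1 + p)"]) simp
qed

definition reach :: "nat \<Rightarrow> prog \<Rightarrow> state \<Rightarrow> state \<Rightarrow> bool" where
  "reach m c s s' \<longleftrightarrow> (\<exists>t. runs c s t s' \<and> t \<le> time_bound c m)"

lemma reach_Skip: "s' = s \<Longrightarrow> reach m Skip s s'"
  unfolding reach_def using runs.Skip by fastforce

lemma reach_Push: "s' = s(r := b # s r) \<Longrightarrow> reach m (Push r b) s s'"
  unfolding reach_def using runs.Push by fastforce

lemma reach_Pop: "s' = s(r := tl (s r)) \<Longrightarrow> reach m (Pop r) s s'"
  unfolding reach_def using runs.Pop by fastforce

lemma reach_Seq: "reach m c1 s s1 \<Longrightarrow> reach m c2 s1 s2 \<Longrightarrow> reach m (Seq c1 c2) s s2"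
  unfolding reach_def by (auto intro: runs.Seq add_mono)

lemma reach_If:
  assumes "holds b s \<Longrightarrow> reach m c1 s s'" "\<not> holds b s \<Longrightarrow> reach m c2 s s'"
  shows "reach m (IfThenElse b c1 c2) s s'"
proof (cases "holds b s")
  case True
  then obtain t where "runs c1 s t s'" "t \<le> time_bound c1 m"
    using assms(1) unfolding reach_def by blast
  then have "runs (IfThenElse b c1 c2) s (Suc t) s'" "Suc t \<le> time_bound (IfThenElse b c1 c2) m"
    using True by (auto intro: runs.IfTrue)
  then show ?thesis unfolding reach_def by blast
next
  case False
  then obtain t where "runs c2 s t s'" "t \<le> time_bound c2 m"
    using assms(2) unfolding reach_def by blast
  then have "runs (IfThenElse b c1 c2) s (Suc t) s'" "Suc t \<le> time_bound (IfThenElse b c1 c2) m"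
    using False by (auto intro: runs.IfFalse)
  then show ?thesis unfolding reach_def by blast
qed

lemma reach_While:
  assumes step: "\<And>i. i < l \<Longrightarrow> holds b (S i)" "\<And>i. i < l \<Longrightarrow> reach m c (S i) (S (Suc i))"
    and stop: "\<not> holds b (S l)" and "l \<le> m"
  shows "reach m (While b c) (S 0) (S l)"
proof -
  have "\<exists>t. runs (While b c) (S (l - j)) t (S l) \<and> t \<le> Suc (j * Suc (time_bound c m))" if "j \<le> l" for j
    using that
  proof (induction j)
    case 0
    then show ?case using runs.WhileFalse[OF stop, of c] by auto
  next
    case (Suc j)
    let ?i = "l - Suc j"
    have i: "?i < l" "Suc ?i = l - j" using Suc.prems by auto
    obtain t2 where t2: "runs (While b c) (S (l - j)) t2 (S l)" "t2 \<le> Suc (j * Suc (time_bound c m))"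
      using Suc by auto
    obtain t1 where t1: "runs c (S ?i) t1 (S (l - j))" "t1 \<le> time_bound c m"
      using step(2)[OF i(1)] i(2) unfolding reach_def by auto
    have "runs (While b c) (S ?i) (Suc (t1 + t2)) (S l)"
      by (rule runs.WhileTrue[OF step(1)[OF i(1)] t1(1) t2(1)])
    then show ?case using t1(2) t2(2) by (intro exI[of _ "Suc (t1 + t2)"]) auto
  qed
  from this[of l] obtain t where "runs (While b c) (S 0) t (S l)" "t \<le> Suc (l * Suc (time_bound c m))"
    by auto
  moreover have "l * Suc (time_bound c m) \<le> m * Suc (time_bound c m)"
    using \<open>l \<le> m\<close> by (rule mult_le_mono1)
  ultimately show ?thesis unfolding reach_def by fastforce
qed

lemma runs_SeqE:
  assumes "runs (Seq a b) s t s'"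
  obtains t1 t2 u where "runs a s t1 u" "runs b u t2 s'" "t = t1 + t2"
  using assms by (cases rule: runs.cases) auto

lemma reach_eq: "reach m c s s' \<Longrightarrow> s' = s'' \<Longrightarrow> reach m c s s''"
  by simp

lemma seq_push: "reach m c (s(r := b # s r)) s' \<Longrightarrow> reach m (Seq (Push r b) c) s s'"
  by (rule reach_Seq[OF reach_Push[OF refl]])

lemma seq_pop: "reach m c (s(r := tl (s r))) s' \<Longrightarrow> reach m (Seq (Pop r) c) s s'"
  by (rule reach_Seq[OF reach_Pop[OF refl]])

lemma seq_seq:
  assumes "reach m (Seq a (Seq b c)) s s'"
  shows "reach m (Seq (Seq a b) c) s s'"
proof -
  obtain t where t: "runs (Seq a (Seq b c)) s t s'" "t \<le> time_bound (Seq a (Seq b c)) m"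
    using assms unfolding reach_def by blast
  from t(1) obtain t1 u t2 v t3 where "runs a s t1 u" "runs b u t2 v" "runs c v t3 s'" "t = t1 + (t2 + t3)"
    by (elim runs_SeqE) blast
  then have "runs (Seq (Seq a b) c) s t s'" by (metis add.assoc runs.Seq)
  then show ?thesis using t(2) unfolding reach_def by (intro exI[of _ t]) simp
qed

lemma seq_if:
  assumes "holds b s \<Longrightarrow> reach m (Seq c1 c) s s'" "\<not> holds b s \<Longrightarrow> reach m (Seq c2 c) s s'"
  shows "reach m (Seq (IfThenElse b c1 c2) c) s s'"
proof (cases "holds b s")
  case True
  then obtain t where t: "runs (Seq c1 c) s t s'" "t \<le> time_bound (Seq c1 c) m"
    using assms(1) unfolding reach_def by blast
  from t(1) obtain t1 t2 u where "runs c1 s t1 u" "runs c u t2 s'" "t = t1 + t2" by (elim runs_SeqE)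
  then have "runs (Seq (IfThenElse b c1 c2) c) s (Suc t) s'"
    using runs.Seq[OF runs.IfTrue[OF True]] by fastforce
  then show ?thesis using t(2) unfolding reach_def by (intro exI[of _ "Suc t"]) simp
next
  case False
  then obtain t where t: "runs (Seq c2 c) s t s'" "t \<le> time_bound (Seq c2 c) m"
    using assms(2) unfolding reach_def by blast
  from t(1) obtain t1 t2 u where "runs c2 s t1 u" "runs c u t2 s'" "t = t1 + t2" by (elim runs_SeqE)
  then have "runs (Seq (IfThenElse b c1 c2) c) s (Suc t) s'"
    using runs.Seq[OF runs.IfFalse[OF False]] by fastforce
  then show ?thesis using t(2) unfolding reach_def by (intro exI[of _ "Suc t"]) simp
qed

lemmas step = seq_seq seq_push seq_pop seq_if reach_Skip reach_Push reach_Pop reach_If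

abbreviation unary :: "nat \<Rightarrow> bool list" where
  "unary n \<equiv> replicate n True"

text \<open>In the \<open>i\<close>-th of \<open>n\<close> rounds, counted from 0, \<open>t\<close> holds \<open>i\<close> and \<open>r\<close> holds \<open>n - Suc i\<close>; the body may read both.\<close>

definition rep :: "nat \<Rightarrow> nat \<Rightarrow> prog \<Rightarrow> prog" where
  "rep r t c = Seq (While (Nonempty r) (Seq (Pop r) (Seq c (Push t True))))
     (While (Nonempty t) (Seq (Pop t) (Push r True)))"

lemma reach_rep:
  assumes "r \<noteq> t" "n \<le> m"
    and body: "\<And>i. i < n \<Longrightarrow> reach m c ((S i)(r := unary (n - Suc i), t := unary i))
      ((S (Suc i))(r := unary (n - Suc i), t := unary i))"
    and s: "s = (S 0)(r := unary n, t := [])"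
    and s': "s' = (S n)(r := unary n, t := [])"
  shows "reach m (rep r t c) s s'"
proof -
  define Q where "Q i = (S i)(r := unary (n - i), t := unary i)" for i
  have Q: "reach m (While (Nonempty r) (Seq (Pop r) (Seq c (Push t True)))) (Q 0) (Q n)"
  proof (rule reach_While)
    fix i assume i: "i < n"
    then have ni: "n - i = Suc (n - Suc i)" by simp
    show "holds (Nonempty r) (Q i)" using i \<open>r \<noteq> t\<close> by (simp add: Q_def)
    show "reach m (Seq (Pop r) (Seq c (Push t True))) (Q i) (Q (Suc i))"
    proof (rule seq_pop, rule reach_Seq)
      show "reach m c ((Q i)(r := tl (Q i r))) ((S (Suc i))(r := unary (n - Suc i), t := unary i))"
        using body[OF i] \<open>r \<noteq> t\<close> unfolding Q_def ni by (simp add: fun_upd_twist)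
      show "reach m (Push t True) ((S (Suc i))(r := unary (n - Suc i), t := unary i)) (Q (Suc i))"
        by (rule reach_Push) (use \<open>r \<noteq> t\<close> in \<open>auto simp: Q_def fun_eq_iff\<close>)
    qed
  qed (use \<open>r \<noteq> t\<close> \<open>n \<le> m\<close> in \<open>auto simp: Q_def\<close>)
  define R where "R i = (S n)(r := unary i, t := unary (n - i))" for i
  have R: "reach m (While (Nonempty t) (Seq (Pop t) (Push r True))) (R 0) (R n)"
  proof (rule reach_While)
    fix i assume i: "i < n"
    then have ni: "n - i = Suc (n - Suc i)" by simp
    show "holds (Nonempty t) (R i)" using i \<open>r \<noteq> t\<close> by (simp add: R_def)
    show "reach m (Seq (Pop t) (Push r True)) (R i) (R (Suc i))"
      by (rule reach_Seq[OF reach_Pop[OF refl] reach_Push])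
        (use \<open>r \<noteq> t\<close> in \<open>auto simp: R_def ni fun_eq_iff\<close>)
  qed (use \<open>r \<noteq> t\<close> \<open>n \<le> m\<close> in \<open>auto simp: R_def\<close>)
  have "Q 0 = s" "Q n = R 0" "R n = s'" using \<open>r \<noteq> t\<close> s s' by (auto simp: Q_def R_def)
  then show ?thesis unfolding rep_def using reach_Seq Q R by metis
qed

definition move :: "nat \<Rightarrow> nat \<Rightarrow> prog" where
  "move a b = While (Nonempty a)
     (Seq (IfThenElse (TopTrue a) (Push b True) (Push b False)) (Pop a))"

lemma reach_move:
  assumes "a \<noteq> b" "length (s a) \<le> m" and s': "s' = s(a := [], b := rev (s a) @ s b)"
  shows "reach m (move a b) s s'"
proof -
  define S where "S i = s(a := drop i (s a), b := rev (take i (s a)) @ s b)" for i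
  have "reach m (move a b) (S 0) (S (length (s a)))"
    unfolding move_def
  proof (rule reach_While)
    fix i assume i: "i < length (s a)"
    then have d: "drop i (s a) = s a ! i # drop (Suc i) (s a)" by (simp add: Cons_nth_drop_Suc)
    show "holds (Nonempty a) (S i)" using i \<open>a \<noteq> b\<close> by (simp add: S_def)
    show "reach m (Seq (IfThenElse (TopTrue a) (Push b True) (Push b False)) (Pop a)) (S i) (S (Suc i))"
      by (intro step) (use i d \<open>a \<noteq> b\<close> in \<open>auto simp: S_def take_Suc_conv_app_nth fun_eq_iff\<close>)
  qed (use assms in \<open>auto simp: S_def\<close>)
  moreover have "S 0 = s" "S (length (s a)) = s'" using assms by (auto simp: S_def)
  ultimately show ?thesis by simp
qed

definition clear :: "nat \<Rightarrow> prog" where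
  "clear r = While (Nonempty r) (Pop r)"

lemma reach_clear:
  assumes "length (s r) \<le> m" and s': "s' = s(r := [])"
  shows "reach m (clear r) s s'"
proof -
  define S where "S i = s(r := drop i (s r))" for i
  have "reach m (clear r) (S 0) (S (length (s r)))"
    unfolding clear_def
  proof (rule reach_While)
    fix i assume i: "i < length (s r)"
    then show "holds (Nonempty r) (S i)" by (simp add: S_def)
    show "reach m (Pop r) (S i) (S (Suc i))"
      by (intro step) (auto simp: S_def tl_drop drop_Suc)
  qed (use assms in \<open>auto simp: S_def\<close>)
  moreover have "S 0 = s" "S (length (s r)) = s'" using assms by (auto simp: S_def)
  ultimately show ?thesis by simp
qed

definition emit :: "nat \<Rightarrow> nat \<Rightarrow> bool \<Rightarrow> prog" where
  "emit r t b = rep r t (Push 14 b)"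

lemma reach_emit:
  assumes "r \<noteq> t" "r \<noteq> 14" "t \<noteq> 14" "s r = unary x" "s t = []" "x \<le> m"
    and s': "s' = s(14 := replicate x b @ s 14)"
  shows "reach m (emit r t b) s s'"
  unfolding emit_def
proof (rule reach_rep[where S = "\<lambda>i. s(14 := replicate i b @ s 14)"])
  fix i assume "i < x"
  show "reach m (Push 14 b) ((s(14 := replicate i b @ s 14))(r := unary (x - Suc i), t := unary i))
     ((s(14 := replicate (Suc i) b @ s 14))(r := unary (x - Suc i), t := unary i))"
    by (intro step) (use assms in \<open>auto simp: fun_eq_iff\<close>)
qed (use assms in \<open>auto simp: fun_eq_iff\<close>)

definition blocks :: "nat \<Rightarrow> bool \<Rightarrow> prog" where
  "blocks r b = rep r 18 (emit 4 5 b)"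

lemma reach_blocks:
  assumes "r \<notin> {4, 5, 14, 18}" "s r = unary x" "s 18 = []" "s 4 = unary n" "s 5 = []"
    "x \<le> m" "n \<le> m" and s': "s' = s(14 := replicate (x * n) b @ s 14)"
  shows "reach m (blocks r b) s s'"
  unfolding blocks_def
proof (rule reach_rep[where S = "\<lambda>i. s(14 := replicate (i * n) b @ s 14)"])
  fix i assume "i < x"
  show "reach m (emit 4 5 b) ((s(14 := replicate (i * n) b @ s 14))(r := unary (x - Suc i), 18 := unary i))
     ((s(14 := replicate (Suc i * n) b @ s 14))(r := unary (x - Suc i), 18 := unary i))"
    by (rule reach_emit[where x = n]) (use assms in \<open>auto simp: fun_eq_iff replicate_add\<close>)
qed (use assms in \<open>auto simp: fun_eq_iff\<close>)

definition scan :: "prog \<Rightarrow> prog \<Rightarrow> prog" where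
  "scan cT cF = rep 4 5 (Seq (IfThenElse (TopTrue 0) (Seq cT (Push 13 True)) (Seq cF (Push 13 False))) (Pop 0))"

lemma reach_scan:
  assumes "length xs = n" "n \<le> m"
    and body: "\<And>i A B a b. i < n \<Longrightarrow> reach m (if xs ! i then cT else cF)
      ((S i)(0 := A, 13 := B, 4 := a, 5 := b)) ((S (Suc i))(0 := A, 13 := B, 4 := a, 5 := b))"
    and s: "s = (S 0)(0 := xs @ ys, 13 := zs, 4 := unary n, 5 := [])"
    and s': "s' = (S n)(0 := ys, 13 := rev xs @ zs, 4 := unary n, 5 := [])"
  shows "reach m (scan cT cF) s s'"
  unfolding scan_def
proof (rule reach_rep[where S = "\<lambda>i. (S i)(0 := drop i xs @ ys, 13 := rev (take i xs) @ zs)"])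
  fix i assume i: "i < n"
  let ?a = "unary (n - Suc i)" and ?b = "unary i" and ?A = "drop i xs @ ys" and ?B = "rev (take i xs) @ zs"
  let ?u = "(S (Suc i))(0 := ?A, 13 := ?B, 4 := ?a, 5 := ?b)"
  have d: "drop i xs = xs ! i # drop (Suc i) xs" using i assms(1) by (simp add: Cons_nth_drop_Suc)
  have 1: "reach m (IfThenElse (TopTrue 0) (Seq cT (Push 13 True)) (Seq cF (Push 13 False)))
      ((S i)(0 := ?A, 13 := ?B, 4 := ?a, 5 := ?b)) (?u(13 := xs ! i # ?B))"
  proof (rule reach_If)
    assume "holds (TopTrue 0) ((S i)(0 := ?A, 13 := ?B, 4 := ?a, 5 := ?b))"
    then have x: "xs ! i" using d by simp
    show "reach m (Seq cT (Push 13 True)) ((S i)(0 := ?A, 13 := ?B, 4 := ?a, 5 := ?b)) (?u(13 := xs ! i # ?B))"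
      by (rule reach_Seq[OF body[OF i, unfolded if_P[OF x]] reach_Push])
        (use x in \<open>auto simp: fun_eq_iff\<close>)
  next
    assume "\<not> holds (TopTrue 0) ((S i)(0 := ?A, 13 := ?B, 4 := ?a, 5 := ?b))"
    then have x: "\<not> xs ! i" using d by simp
    show "reach m (Seq cF (Push 13 False)) ((S i)(0 := ?A, 13 := ?B, 4 := ?a, 5 := ?b)) (?u(13 := xs ! i # ?B))"
      by (rule reach_Seq[OF body[OF i, unfolded if_not_P[OF x]] reach_Push])
        (use x in \<open>auto simp: fun_eq_iff\<close>)
  qed
  show "reach m (Seq (IfThenElse (TopTrue 0) (Seq cT (Push 13 True)) (Seq cF (Push 13 False))) (Pop 0))
     ((S i)(0 := drop i xs @ ys, 13 := rev (take i xs) @ zs, 4 := ?a, 5 := ?b))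
     ((S (Suc i))(0 := drop (Suc i) xs @ ys, 13 := rev (take (Suc i) xs) @ zs, 4 := ?a, 5 := ?b))"
    by (rule reach_Seq[OF 1 reach_Pop])
      (use i d assms(1) in \<open>auto simp: fun_eq_iff take_Suc_conv_app_nth\<close>)
qed (use assms in \<open>auto simp: fun_eq_iff\<close>)

primrec rename_test :: "(nat \<Rightarrow> nat) \<Rightarrow> test \<Rightarrow> test" where
  "rename_test f (Nonempty r) = Nonempty (f r)"
| "rename_test f (TopTrue r) = TopTrue (f r)"

primrec rename :: "(nat \<Rightarrow> nat) \<Rightarrow> prog \<Rightarrow> prog" where
  "rename f Skip = Skip"
| "rename f (Push r b) = Push (f r) b"
| "rename f (Pop r) = Pop (f r)"
| "rename f (Seq c1 c2) = Seq (rename f c1) (rename f c2)"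
| "rename f (IfThenElse b c1 c2) = IfThenElse (rename_test f b) (rename f c1) (rename f c2)"
| "rename f (While b c) = While (rename_test f b) (rename f c)"

lemma holds_rename_test: "(\<And>r. u (f r) = s r) \<Longrightarrow> holds (rename_test f b) u = holds b s"
  by (cases b) auto

lemma runs_rename:
  assumes "inj f"
  shows "runs c s t s' \<Longrightarrow> (\<And>r. u (f r) = s r) \<Longrightarrow>
    \<exists>u'. runs (rename f c) u t u' \<and> (\<forall>r. u' (f r) = s' r) \<and> (\<forall>q. q \<notin> range f \<longrightarrow> u' q = u q)"
proof (induction arbitrary: u rule: runs.induct)
  case (Skip s)
  then show ?case using runs.Skip by fastforce
next
  case (Push r b s)
  have "(u(f r := b # u (f r))) (f x) = (s(r := b # s r)) x" for x
    using Push by (simp add: inj_eq[OF assms])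
  moreover have "(u(f r := b # u (f r))) q = u q" if "q \<notin> range f" for q
    using that by auto
  ultimately show ?case using runs.Push[of "f r" b u] by (metis rename.simps(2))
next
  case (Pop r s)
  have "(u(f r := tl (u (f r)))) (f x) = (s(r := tl (s r))) x" for x
    using Pop by (simp add: inj_eq[OF assms])
  moreover have "(u(f r := tl (u (f r)))) q = u q" if "q \<notin> range f" for q
    using that by auto
  ultimately show ?case using runs.Pop[of "f r" u] by (metis rename.simps(3))
next
  case (Seq c1 s t1 s1 c2 t2 s2)
  obtain v where v: "runs (rename f c1) u t1 v" "\<forall>r. v (f r) = s1 r" "\<forall>q. q \<notin> range f \<longrightarrow> v q = u q"
    using Seq.IH(1)[of u] Seq.prems by blast
  obtain w where w: "runs (rename f c2) v t2 w" "\<forall>r. w (f r) = s2 r"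
      "\<forall>q. q \<notin> range f \<longrightarrow> w q = v q"
    using Seq.IH(2)[of v] v(2) by blast
  have "runs (rename f (Seq c1 c2)) u (t1 + t2) w"
    using runs.Seq v(1) w(1) by simp
  then show ?case using v(3) w(2,3) by auto
next
  case (IfTrue b s c1 t s1 c2)
  obtain v where v: "runs (rename f c1) u t v" "\<forall>r. v (f r) = s1 r" "\<forall>q. q \<notin> range f \<longrightarrow> v q = u q"
    using IfTrue.IH[of u] IfTrue.prems by blast
  have "holds (rename_test f b) u" using IfTrue holds_rename_test by blast
  then have "runs (rename f (IfThenElse b c1 c2)) u (Suc t) v"
    using runs.IfTrue v(1) by simp
  then show ?case using v(2,3) by blast
next
  case (IfFalse b s c2 t s1 c1)
  obtain v where v: "runs (rename f c2) u t v" "\<forall>r. v (f r) = s1 r" "\<forall>q. q \<notin> range f \<longrightarrow> v q = u q"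
    using IfFalse.IH[of u] IfFalse.prems by blast
  have "\<not> holds (rename_test f b) u" using IfFalse holds_rename_test by blast
  then have "runs (rename f (IfThenElse b c1 c2)) u (Suc t) v"
    using runs.IfFalse v(1) by simp
  then show ?case using v(2,3) by blast
next
  case (WhileFalse b s c)
  have "\<not> holds (rename_test f b) u" using WhileFalse holds_rename_test by blast
  then have "runs (rename f (While b c)) u 1 u" using runs.WhileFalse by simp
  then show ?case using WhileFalse.prems by auto
next
  case (WhileTrue b s c t1 s1 t2 s2)
  obtain v where v: "runs (rename f c) u t1 v" "\<forall>r. v (f r) = s1 r" "\<forall>q. q \<notin> range f \<longrightarrow> v q = u q"
    using WhileTrue.IH(1)[of u] WhileTrue.prems by blast
  obtain w where w: "runs (rename f (While b c)) v t2 w" "\<forall>r. w (f r) = s2 r"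
      "\<forall>q. q \<notin> range f \<longrightarrow> w q = v q"
    using WhileTrue.IH(2)[of v] v(2) by blast
  have "holds (rename_test f b) u" using WhileTrue holds_rename_test by blast
  then have "runs (rename f (While b c)) u (Suc (t1 + t2)) w"
    using runs.WhileTrue v(1) w(1) by simp
  then show ?case using v(3) w(2,3) by auto
qed

section \<open>The regularized graph\<close>

text \<open>Vertex \<open>i\<close> owns the block of pad vertices \<open>n + (i * n + l)\<close>, \<open>l < n\<close>.\<close>

definition pad_edges :: "nat \<Rightarrow> nat set set \<Rightarrow> nat set set" where
  "pad_edges n E = {{i, n + (i * n + l)} | i l. i < n \<and> l < max_degree n E - vertex_degree E i}"

definition pad_clique :: "nat \<Rightarrow> nat set set" where
  "pad_clique n = {{n + y, n + z} | y z. y < n * n \<and> z < n * n \<and> y \<noteq> z}"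

definition regularize :: "nat \<Rightarrow> nat set set \<Rightarrow> nat set set" where
  "regularize n E = E \<union> pad_edges n E \<union> pad_clique n"

lemma block_less: "i < n \<Longrightarrow> l < n \<Longrightarrow> i * n + l < n * (n::nat)"
proof -
  assume "i < n" "l < n"
  then have "i * n + l < Suc i * n" by simp
  also have "\<dots> \<le> n * n" using \<open>i < n\<close> by (intro mult_le_mono1) simp
  finally show ?thesis .
qed

lemma block_eq_iff: "l < n \<Longrightarrow> l' < n \<Longrightarrow> i * n + l = j * n + l' \<longleftrightarrow> i = j \<and> l = (l'::nat)"
  by (metis add.commute add_left_cancel div_mult_self3 div_less add_0_right gr_implies_not0)

context
  fixes n :: nat and E :: "nat set set"
  assumes simple: "simple_graph n E"
begin

lemma edgeE:
  assumes "e \<in> E"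
  obtains a b where "e = {a, b}" "a < n" "b < n" "a \<noteq> b"
proof -
  have "card e = 2" "e \<subseteq> {..<n}" using simple assms by (auto simp: simple_graph_def)
  then show thesis using that by (metis card_2_iff insert_subset lessThan_iff)
qed

lemma finite_edges: "finite E"
  by (rule finite_subset[of _ "Pow {..<n}"]) (use simple in \<open>auto simp: simple_graph_def\<close>)

lemma vertex_degree_eq_card_nbrs: "vertex_degree E i = card {j. j < n \<and> {i, j} \<in> E}"
proof -
  have "{e \<in> E. i \<in> e} = (\<lambda>j. {i, j}) ` {j. j < n \<and> {i, j} \<in> E}"
  proof (intro set_eqI iffI)
    fix e assume "e \<in> {e \<in> E. i \<in> e}"
    then have e: "e \<in> E" "i \<in> e" by auto
    then obtain a b where ab: "e = {a, b}" "a < n" "b < n" by (elim edgeE)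
    then have "e = {i, a} \<and> {i, a} \<in> E \<or> e = {i, b} \<and> {i, b} \<in> E"
      using e by (auto simp: insert_commute)
    then show "e \<in> (\<lambda>j. {i, j}) ` {j. j < n \<and> {i, j} \<in> E}" using ab by blast
  qed auto
  moreover have "inj_on (\<lambda>j. {i, j}) X" for X :: "nat set"
    by (auto simp: inj_on_def doubleton_eq_iff)
  ultimately show ?thesis unfolding vertex_degree_def by (simp add: card_image)
qed

lemma vertex_degree_less: "i < n \<Longrightarrow> vertex_degree E i < n"
proof -
  assume i: "i < n"
  have "{i, i} \<notin> E" using simple by (auto simp: simple_graph_def)
  then have "i \<in> {..<n} - {j. j < n \<and> {i, j} \<in> E}" using i by simp
  then have "{j. j < n \<and> {i, j} \<in> E} \<subset> {..<n}" by blast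
  then have "card {j. j < n \<and> {i, j} \<in> E} < card {..<n}" by (intro psubset_card_mono) auto
  then show ?thesis by (simp add: vertex_degree_eq_card_nbrs)
qed

lemma vertex_degree_le_max: "i < n \<Longrightarrow> vertex_degree E i \<le> max_degree n E"
  unfolding max_degree_def by (intro Max_ge) auto

lemma max_degree_less: "0 < n \<Longrightarrow> max_degree n E < n"
  unfolding max_degree_def by (subst Max_less_iff) (auto simp: vertex_degree_less)

lemma pad_edgeE:
  assumes "e \<in> pad_edges n E"
  obtains i l where "e = {i, n + (i * n + l)}" "i < n" "l < max_degree n E - vertex_degree E i" "l < n"
proof -
  obtain i l where il: "e = {i, n + (i * n + l)}" "i < n" "l < max_degree n E - vertex_degree E i"
    using assms unfolding pad_edges_def by blast
  moreover have "l < n" using max_degree_less il by simp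
  ultimately show thesis by (rule that)
qed

lemma simple_regularize: "simple_graph (n + n * n) (regularize n E)"
  unfolding simple_graph_def
proof
  fix e assume "e \<in> regularize n E"
  then consider "e \<in> E" | "e \<in> pad_edges n E" | "e \<in> pad_clique n" unfolding regularize_def by blast
  then show "e \<subseteq> {..<n + n * n} \<and> card e = 2"
  proof cases
    case 1
    then show ?thesis using simple by (force simp: simple_graph_def)
  next
    case 2
    then show ?thesis by (elim pad_edgeE) (use block_less in auto)
  next
    case 3
    then show ?thesis unfolding pad_clique_def by auto
  qed
qed

lemma regularize_old: "i < n \<Longrightarrow> j < n \<Longrightarrow> {i, j} \<in> regularize n E \<longleftrightarrow> {i, j} \<in> E"
  unfolding regularize_def pad_edges_def pad_clique_def by (auto simp: doubleton_eq_iff)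

lemma regularize_cross:
  assumes "i < n" "j < n" "l < n"
  shows "{i, n + (j * n + l)} \<in> regularize n E \<longleftrightarrow> i = j \<and> l < max_degree n E - vertex_degree E i"
proof
  assume "{i, n + (j * n + l)} \<in> regularize n E"
  moreover have "{i, n + (j * n + l)} \<notin> E" by (auto elim!: edgeE simp: doubleton_eq_iff)
  moreover have "{i, n + (j * n + l)} \<notin> pad_clique n"
    using assms by (auto simp: pad_clique_def doubleton_eq_iff)
  ultimately have "{i, n + (j * n + l)} \<in> pad_edges n E" unfolding regularize_def by blast
  then show "i = j \<and> l < max_degree n E - vertex_degree E i"
  proof (elim pad_edgeE)
    fix i' l'
    assume a: "{i, n + (j * n + l)} = {i', n + (i' * n + l')}" "i' < n" "l' < n"
      "l' < max_degree n E - vertex_degree E i'"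
    then have "i = i' \<and> j * n + l = i' * n + l'" using assms by (auto simp: doubleton_eq_iff)
    then show ?thesis using a assms by (simp add: block_eq_iff)
  qed
next
  assume "i = j \<and> l < max_degree n E - vertex_degree E i"
  then show "{i, n + (j * n + l)} \<in> regularize n E"
    using assms unfolding regularize_def pad_edges_def by blast
qed

lemma regularize_clique:
  assumes "y < n * n" "z < n * n"
  shows "{n + y, n + z} \<in> regularize n E \<longleftrightarrow> y \<noteq> z"
proof -
  have "{n + y, n + z} \<notin> E" by (auto elim!: edgeE simp: doubleton_eq_iff)
  moreover have "{n + y, n + z} \<notin> pad_edges n E" by (auto elim!: pad_edgeE simp: doubleton_eq_iff)
  ultimately show ?thesis using assms unfolding regularize_def pad_clique_def
    by (auto simp: doubleton_eq_iff)
qed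

lemma vertex_degree_regularize:
  assumes "i < n"
  shows "vertex_degree (regularize n E) i = max_degree n E"
proof -
  let ?P = "(\<lambda>l. {i, n + (i * n + l)}) ` {..<max_degree n E - vertex_degree E i}"
  have "{e \<in> regularize n E. i \<in> e} = {e \<in> E. i \<in> e} \<union> ?P"
    using assms unfolding regularize_def pad_clique_def pad_edges_def by auto
  moreover have "{e \<in> E. i \<in> e} \<inter> ?P = {}" by (auto elim!: edgeE simp: doubleton_eq_iff)
  moreover have "card ?P = max_degree n E - vertex_degree E i"
    by (subst card_image) (auto simp: inj_on_def doubleton_eq_iff)
  moreover have "finite {e \<in> E. i \<in> e}" using finite_edges by simp
  ultimately show ?thesis
    using vertex_degree_le_max[OF assms] unfolding vertex_degree_def
    by (simp add: card_Un_disjoint)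
qed

lemma sum_vertex_degree:
  assumes "finite U"
  shows "(\<Sum>v\<in>U. vertex_degree E v) = edges_touching E U + edges_inside E U"
proof -
  have "(\<Sum>v\<in>U. vertex_degree E v) = (\<Sum>v\<in>U. \<Sum>e\<in>E. if v \<in> e then 1 else 0)"
    unfolding vertex_degree_def using finite_edges
    by (simp add: sum.If_cases Int_def)
  also have "\<dots> = (\<Sum>e\<in>E. \<Sum>v\<in>U. if v \<in> e then 1 else 0)" by (rule sum.swap)
  also have "\<dots> = (\<Sum>e\<in>E. (if e \<inter> U \<noteq> {} then 1 else 0) + (if e \<subseteq> U then 1 else 0))"
  proof (rule sum.cong[OF refl])
    fix e assume "e \<in> E"
    then obtain a b where ab: "e = {a, b}" "a \<noteq> b" by (elim edgeE)
    have "(\<Sum>v\<in>U. if v \<in> e then 1 else (0::nat)) = card (U \<inter> e)"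
      using assms by (simp add: sum.If_cases Int_def)
    also have "\<dots> = (if e \<inter> U \<noteq> {} then 1 else 0) + (if e \<subseteq> U then 1 else 0)"
      using ab by (cases "a \<in> U"; cases "b \<in> U") (auto simp: Int_insert_right)
    finally show "(\<Sum>v\<in>U. if v \<in> e then 1 else (0::nat)) =
      (if e \<inter> U \<noteq> {} then 1 else 0) + (if e \<subseteq> U then 1 else 0)" .
  qed
  also have "\<dots> = edges_touching E U + edges_inside E U"
    unfolding edges_touching_def edges_inside_def using finite_edges
    by (simp add: sum.distrib sum.If_cases Int_def)
  finally show ?thesis .
qed

lemma edges_touching_mono:
  assumes "U \<subseteq> W"
  shows "edges_touching E U \<le> edges_touching E W"
  unfolding edges_touching_def
  by (rule card_mono) (use assms finite_edges in auto)

end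

context
  fixes n :: nat and E :: "nat set set"
  assumes simple: "simple_graph n E"
begin

lemma edges_inside_regularize:
  assumes "U \<subseteq> {..<n}"
  shows "edges_inside (regularize n E) U = edges_inside E U"
proof -
  have "{e \<in> regularize n E. e \<subseteq> U} = {e \<in> E. e \<subseteq> U}"
    using assms unfolding regularize_def pad_clique_def pad_edges_def by auto
  then show ?thesis by (simp add: edges_inside_def)
qed

lemma edges_touching_regularize:
  assumes "U \<subseteq> {..<n}"
  shows "edges_touching (regularize n E) U + edges_inside E U = max_degree n E * card U"
proof -
  have "finite U" using assms finite_subset by blast
  then have "edges_touching (regularize n E) U + edges_inside (regularize n E) U =
      (\<Sum>v\<in>U. vertex_degree (regularize n E) v)"
    using sum_vertex_degree[OF simple_regularize[OF simple]] by simp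
  also have "\<dots> = (\<Sum>v\<in>U. max_degree n E)"
    using assms by (intro sum.cong refl vertex_degree_regularize[OF simple]) auto
  finally show ?thesis using assms by (simp add: edges_inside_regularize)
qed

lemma edges_touching_pad:
  assumes "n + y \<in> U" "y < n * n"
  shows "n * n - 1 \<le> edges_touching (regularize n E) U"
proof -
  let ?P = "(\<lambda>z. {n + y, n + z}) ` ({..<n * n} - {y})"
  have "card ?P = n * n - 1"
    using assms by (subst card_image) (auto simp: inj_on_def doubleton_eq_iff)
  moreover have "card ?P \<le> card {e \<in> regularize n E. e \<inter> U \<noteq> {}}"
  proof (rule card_mono)
    show "finite {e \<in> regularize n E. e \<inter> U \<noteq> {}}"
      using finite_edges[OF simple_regularize[OF simple]] by simp
    show "?P \<subseteq> {e \<in> regularize n E. e \<inter> U \<noteq> {}}"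
      using assms regularize_clique[OF simple] by auto
  qed
  ultimately show ?thesis unfolding edges_touching_def by simp
qed

lemma dks_opt_attained:
  assumes "k \<le> n"
  obtains U where "U \<subseteq> {..<n}" "card U = k" "edges_inside E U = dks_opt (n, E, k)"
proof -
  let ?S = "{edges_inside E U | U. U \<subseteq> {..<n} \<and> card U = k}"
  have "finite ?S" by simp
  moreover have "?S \<noteq> {}" using assms by (auto intro!: exI[of _ "{..<k}"])
  ultimately have "Max ?S \<in> ?S" by (rule Max_in)
  then show thesis using that unfolding dks_opt_def by auto
qed

lemma fcec_opt_regularize:
  assumes "k \<le> n"
  shows "fcec_opt (n + n * n, regularize n E, k) + dks_opt (n, E, k) \<le> max_degree n E * k"
proof -
  obtain U where U: "U \<subseteq> {..<n}" "card U = k" "edges_inside E U = dks_opt (n, E, k)"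
    by (rule dks_opt_attained[OF assms])
  have "fcec_opt (n + n * n, regularize n E, k) \<le> edges_touching (regularize n E) U"
    unfolding fcec_opt_def prod.case by (rule Min_le) (use U in \<open>auto intro!: exI[of _ U]\<close>)
  then show ?thesis using edges_touching_regularize[OF U(1)] U by simp
qed

text \<open>A pad vertex alone touches more edges than the approximate solution may, so the cover avoids
  all of them; dropping surplus vertices never increases the cost.\<close>

lemma approx_transfer:
  assumes k: "0 < k" "k \<le> n" and eps: "0 < \<epsilon>" "2 * \<epsilon> * (real k * real (max_degree n E)) \<le> real (dks_opt (n, E, k))"
    and pos: "0 < dks_opt (n, E, k)"
    and y: "fcec_approx (1 + \<epsilon>) (n + n * n, regularize n E, k) y"
  shows "k \<le> card {v. v < n \<and> y ! v}"
    and "U \<subseteq> {v. v < n \<and> y ! v} \<Longrightarrow> card U = k \<Longrightarrow> real (dks_opt (n, E, k)) \<le> 2 * real (edges_inside E U)"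
proof -
  let ?W = "decode_set y" and ?D = "max_degree n E" and ?m = "dks_opt (n, E, k)"
  let ?E' = "regularize n E"
  have len: "length y = n + n * n" and kW: "k \<le> card ?W"
    and cost: "real (edges_touching ?E' ?W) \<le> (1 + \<epsilon>) * real (fcec_opt (n + n * n, ?E', k))"
    using y by (auto simp: fcec_approx_def)
  have "real (fcec_opt (n + n * n, ?E', k)) \<le> real k * real ?D - real ?m"
    using fcec_opt_regularize[OF k(2)]
    by (metis add.commute le_diff_eq mult.commute of_nat_add of_nat_le_iff of_nat_mult)
  then have "(1 + \<epsilon>) * real (fcec_opt (n + n * n, ?E', k)) \<le> (1 + \<epsilon>) * (real k * real ?D - real ?m)"
    using eps(1) by (intro mult_left_mono) auto
  also have "\<dots> \<le> real k * real ?D - real ?m + \<epsilon> * (real k * real ?D)"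
    using eps(1) by (simp add: algebra_simps)
  also have "\<dots> \<le> real k * real ?D - real ?m / 2" using eps(2) by simp
  finally have cost': "real (edges_touching ?E' ?W) \<le> real k * real ?D - real ?m / 2"
    using cost by linarith
  have "v < n" if v: "v \<in> ?W" for v
  proof (rule ccontr)
    assume "\<not> v < n"
    then obtain z where z: "v = n + z" by (metis le_Suc_ex not_less)
    then have "z < n * n" using v len by (auto simp: decode_set_def)
    then have "n * n - 1 \<le> edges_touching ?E' ?W" using edges_touching_pad v z by blast
    then have "real (n * n - 1) < real (k * ?D)" using cost' pos by simp
    moreover have "k * ?D \<le> n * (n - 1)"
      using k max_degree_less[OF simple] by (intro mult_le_mono) auto
    moreover have "n * (n - 1) \<le> n * n - 1" using k by (simp add: diff_mult_distrib2)
    ultimately show False by linarith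
  qed
  then have W: "?W = {v. v < n \<and> y ! v}" using len by (auto simp: decode_set_def)
  then show "k \<le> card {v. v < n \<and> y ! v}" using kW by simp
  assume U: "U \<subseteq> {v. v < n \<and> y ! v}" "card U = k"
  have "edges_touching ?E' U \<le> edges_touching ?E' ?W"
    using edges_touching_mono[OF simple_regularize[OF simple]] U(1) W by simp
  moreover have "real (edges_touching ?E' U) + real (edges_inside E U) = real k * real ?D"
  proof -
    have "U \<subseteq> {..<n}" using U(1) by auto
    then have "edges_touching ?E' U + edges_inside E U = k * ?D"
      using edges_touching_regularize U(2) by (simp add: mult.commute)
    then show ?thesis by (metis of_nat_add of_nat_mult)
  qed
  ultimately show "real ?m \<le> 2 * real (edges_inside E U)" using cost' by linarith
qed

end

section \<open>Computing the code of the regularized graph\<close>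

definition count_true :: "bool list \<Rightarrow> nat \<Rightarrow> nat" where
  "count_true y i = card {j. j < i \<and> y ! j}"

lemma count_true_0 [simp]: "count_true y 0 = 0"
  by (simp add: count_true_def)

lemma count_true_Suc [simp]: "count_true y (Suc i) = count_true y i + (if y ! i then 1 else 0)"
proof -
  have "{j. j < Suc i \<and> y ! j} = (if y ! i then insert i {j. j < i \<and> y ! j} else {j. j < i \<and> y ! j})"
    by (auto simp: less_Suc_eq)
  then show ?thesis by (simp add: count_true_def)
qed

lemma count_true_le: "count_true y i \<le> i"
  by (induction i) auto

text \<open>Registers 4, 6 and 10 hold \<open>n\<close>, \<open>n\<close> and \<open>k\<close>, and 2 a third copy of \<open>n\<close>; 3, 5, 7, 11, 16 and 18 are the
  counters of the loops over 2, 4, 6, 10, 15 and of those run inside a loop over 2 or 6. The adjacency matrix is on 0, its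
  consumed part on 13, the output, reversed, on 14, the maximum degree on 15, and the number of pad
  edges still due at the current vertex on 17.\<close>

definition layout :: "nat \<Rightarrow> nat \<Rightarrow> bool list \<Rightarrow> nat \<Rightarrow> nat \<Rightarrow> nat \<Rightarrow> nat \<Rightarrow> bool list \<Rightarrow> bool list \<Rightarrow>
    nat \<Rightarrow> nat \<Rightarrow> state" where
  "layout n k A p q l r B Out D W = (\<lambda>_. [])(0 := A, 2 := unary p, 3 := unary q, 4 := unary n,
     6 := unary l, 7 := unary r, 10 := unary k, 13 := B, 14 := Out, 15 := unary D, 17 := unary W)"

lemma layout_apply [simp]:
  "layout n k A p q l r B Out D W 0 = A"
  "layout n k A p q l r B Out D W 2 = unary p"
  "layout n k A p q l r B Out D W 3 = unary q"
  "layout n k A p q l r B Out D W 4 = unary n"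
  "layout n k A p q l r B Out D W 5 = []"
  "layout n k A p q l r B Out D W 6 = unary l"
  "layout n k A p q l r B Out D W 7 = unary r"
  "layout n k A p q l r B Out D W 10 = unary k"
  "layout n k A p q l r B Out D W 11 = []"
  "layout n k A p q l r B Out D W 13 = B"
  "layout n k A p q l r B Out D W 14 = Out"
  "layout n k A p q l r B Out D W 15 = unary D"
  "layout n k A p q l r B Out D W 16 = []"
  "layout n k A p q l r B Out D W 17 = unary W"
  "layout n k A p q l r B Out D W 18 = []"
  by (simp_all add: layout_def)

definition load :: prog where
  "load = rep 15 16 (Push 17 True)"

lemma reach_load:
  assumes "D \<le> m"
  shows "reach m load (layout n k A p q l r B Out D 0) (layout n k A p q l r B Out D D)"
  unfolding load_def
proof (rule reach_rep[where S = "\<lambda>i. layout n k A p q l r B Out D i"])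
  fix i assume "i < D"
  show "reach m (Push 17 True)
     ((layout n k A p q l r B Out D i)(15 := unary (D - Suc i), 16 := unary i))
     ((layout n k A p q l r B Out D (Suc i))(15 := unary (D - Suc i), 16 := unary i))"
    by (intro step) (auto simp: layout_def fun_eq_iff)
qed (use assms in \<open>auto simp: layout_def fun_eq_iff\<close>)

text \<open>Each one in the row first uses up a unit of a copy of \<open>D\<close>; once that is empty, \<open>D\<close> itself grows.\<close>

definition max_row :: prog where
  "max_row = Seq load (Seq (scan (IfThenElse (Nonempty 17) (Pop 17) (Push 15 True)) Skip) (clear 17))"

lemma reach_max_row:
  assumes "length xs = n" "n \<le> m" "D \<le> n"
  shows "reach m max_row (layout n k (xs @ ys) p q l r B Out D 0)
    (layout n k ys p q l r (rev xs @ B) Out (max D (count_true xs n)) 0)"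
  unfolding max_row_def
proof (rule reach_Seq[OF reach_load reach_Seq])
  let ?S = "\<lambda>i. layout n k [] p q l r [] Out (max D (count_true xs i)) (D - count_true xs i)"
  show "reach m (scan (IfThenElse (Nonempty 17) (Pop 17) (Push 15 True)) Skip)
    (layout n k (xs @ ys) p q l r B Out D D)
    (layout n k ys p q l r (rev xs @ B) Out (max D (count_true xs n)) (D - count_true xs n))"
  proof (rule reach_scan[where S = ?S])
    fix i C B' a b assume i: "i < n"
    show "reach m (if xs ! i then IfThenElse (Nonempty 17) (Pop 17) (Push 15 True) else Skip)
      ((?S i)(0 := C, 13 := B', 4 := a, 5 := b)) ((?S (Suc i))(0 := C, 13 := B', 4 := a, 5 := b))"
    proof (cases "xs ! i")
      case True
      have "reach m (IfThenElse (Nonempty 17) (Pop 17) (Push 15 True))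
      ((?S i)(0 := C, 13 := B', 4 := a, 5 := b)) ((?S (Suc i))(0 := C, 13 := B', 4 := a, 5 := b))"
      proof (cases "count_true xs i < D")
        case lt: True
        then have "D - count_true xs i = Suc (D - Suc (count_true xs i))"
          "max D (Suc (count_true xs i)) = D" "max D (count_true xs i) = D" by auto
        then show ?thesis
          by (intro step) (use True in \<open>auto simp: layout_def fun_eq_iff\<close>)
      next
        case False
        then have "D - count_true xs i = 0" "D - Suc (count_true xs i) = 0"
          "max D (Suc (count_true xs i)) = Suc (count_true xs i)"
          "max D (count_true xs i) = count_true xs i" by auto
        then show ?thesis
          by (intro step) (use True in \<open>auto simp: layout_def fun_eq_iff\<close>)
      qed
      with True show ?thesis by simp
    next
      case False
      then have "reach m Skip ((?S i)(0 := C, 13 := B', 4 := a, 5 := b))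
          ((?S (Suc i))(0 := C, 13 := B', 4 := a, 5 := b))"
        by (intro step) simp
      with False show ?thesis by simp
    qed
  qed (use assms in \<open>auto simp: layout_def fun_eq_iff\<close>)
  show "reach m (clear 17)
    (layout n k ys p q l r (rev xs @ B) Out (max D (count_true xs n)) (D - count_true xs n))
    (layout n k ys p q l r (rev xs @ B) Out (max D (count_true xs n)) 0)"
    by (rule reach_clear) (use assms in \<open>auto simp: layout_def fun_eq_iff\<close>)
qed (use assms in simp)

definition old_row :: prog where
  "old_row = Seq load (Seq (scan (Seq (Push 14 True) (Pop 17)) (Push 14 False))
     (Seq (blocks 3 False)
     (Seq (rep 4 5 (IfThenElse (Nonempty 17) (Seq (Pop 17) (Push 14 True)) (Push 14 False)))
       (blocks 2 False))))"

lemma reach_old_row: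
  assumes "length xs = n" "n \<le> m" "D \<le> n" "p \<le> m" "q \<le> m"
  shows "reach m old_row (layout n k (xs @ ys) p q l r B Out D 0)
    (layout n k ys p q l r (rev xs @ B)
      (rev (xs @ replicate (q * n) False @ map (\<lambda>l. l < D - count_true xs n) [0..<n] @
        replicate (p * n) False) @ Out) D 0)"
  unfolding old_row_def
proof (rule reach_Seq[OF reach_load reach_Seq[OF _ reach_Seq[OF _ reach_Seq]]])
  let ?S = "\<lambda>i. layout n k [] p q l r [] (rev (take i xs) @ Out) D (D - count_true xs i)"
  let ?w = "D - count_true xs n"
  show "reach m (scan (Seq (Push 14 True) (Pop 17)) (Push 14 False))
    (layout n k (xs @ ys) p q l r B Out D D)
    (layout n k ys p q l r (rev xs @ B) (rev xs @ Out) D ?w)"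
  proof (rule reach_scan[where S = ?S])
    fix i C B' a b assume i: "i < n"
    have t: "take (Suc i) xs = take i xs @ [xs ! i]" using i assms by (simp add: take_Suc_conv_app_nth)
    have d: "tl (unary (D - count_true xs i)) = unary (D - Suc (count_true xs i))"
      by (cases "D - count_true xs i") (auto simp flip: diff_Suc_eq_diff_pred)
    show "reach m (if xs ! i then Seq (Push 14 True) (Pop 17) else Push 14 False)
      ((?S i)(0 := C, 13 := B', 4 := a, 5 := b)) ((?S (Suc i))(0 := C, 13 := B', 4 := a, 5 := b))"
      unfolding t
      by (cases "xs ! i"; simp only: if_True if_False; intro step)
        (auto simp: layout_def fun_eq_iff d)
  qed (use assms in \<open>auto simp: layout_def fun_eq_iff\<close>)
  show "reach m (blocks 3 False) (layout n k ys p q l r (rev xs @ B) (rev xs @ Out) D ?w)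
    (layout n k ys p q l r (rev xs @ B) (replicate (q * n) False @ rev xs @ Out) D ?w)"
    by (rule reach_blocks[where x = q]) (use assms in \<open>auto simp: layout_def fun_eq_iff\<close>)
  let ?O = "replicate (q * n) False @ rev xs @ Out"
  let ?m = "\<lambda>i. map (\<lambda>l. l < ?w) [0..<i]"
  show "reach m (rep 4 5 (IfThenElse (Nonempty 17) (Seq (Pop 17) (Push 14 True)) (Push 14 False)))
    (layout n k ys p q l r (rev xs @ B) ?O D ?w)
    (layout n k ys p q l r (rev xs @ B) (rev (?m n) @ ?O) D 0)"
  proof (rule reach_rep[where S = "\<lambda>i. layout n k ys p q l r (rev xs @ B) (rev (?m i) @ ?O) D (?w - i)"])
    fix i assume i: "i < n"
    show "reach m (IfThenElse (Nonempty 17) (Seq (Pop 17) (Push 14 True)) (Push 14 False))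
      ((layout n k ys p q l r (rev xs @ B) (rev (?m i) @ ?O) D (?w - i))(4 := unary (n - Suc i), 5 := unary i))
      ((layout n k ys p q l r (rev xs @ B) (rev (?m (Suc i)) @ ?O) D (?w - Suc i))
        (4 := unary (n - Suc i), 5 := unary i))"
    proof (cases "i < ?w")
      case True
      then have "?w - i = Suc (?w - Suc i)" by simp
      then show ?thesis
        by (intro step) (use True in \<open>auto simp: layout_def fun_eq_iff\<close>)
    next
      case False
      then have "?w - i = 0" "?w - Suc i = 0" by simp_all
      then show ?thesis
        by (intro step) (use False in \<open>auto simp: layout_def fun_eq_iff\<close>)
    qed
  qed (use assms in \<open>auto simp: layout_def fun_eq_iff\<close>)
  show "reach m (blocks 2 False)
    (layout n k ys p q l r (rev xs @ B) (rev (?m n) @ ?O) D 0)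
    (layout n k ys p q l r (rev xs @ B)
      (rev (xs @ replicate (q * n) False @ ?m n @ replicate (p * n) False) @ Out) D 0)"
    by (rule reach_blocks[where x = p]) (use assms in \<open>auto simp: layout_def fun_eq_iff\<close>)
qed (use assms in simp)

definition pad_row :: prog where
  "pad_row = Seq (emit 3 18 False) (Seq (IfThenElse (Nonempty 17) (Seq (Pop 17) (Push 14 True)) (Push 14 False))
     (Seq (emit 2 18 False) (Seq (blocks 3 True) (Seq (emit 7 18 True) (Seq (Push 14 False)
     (Seq (emit 6 18 True) (blocks 2 True)))))))"

lemma reach_pad_row:
  assumes "n \<le> m" "p \<le> m" "q \<le> m" "l \<le> m" "r \<le> m"
  shows "reach m pad_row (layout n k A p q l r B Out D W)
    (layout n k A p q l r B
      (rev (replicate q False @ [0 < W] @ replicate p False @ replicate (q * n) True @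
        replicate r True @ [False] @ replicate l True @ replicate (p * n) True) @ Out) D (W - 1))"
  unfolding pad_row_def
proof (rule reach_Seq[OF _ reach_Seq[OF _ reach_Seq[OF _ reach_Seq[OF _ reach_Seq[OF _ reach_Seq[OF _ reach_Seq]]]]]])
  let ?L = "\<lambda>Y W. layout n k A p q l r B Y D W"
  let ?O1 = "replicate q False @ Out"
  let ?O2 = "(0 < W) # ?O1"
  let ?O3 = "replicate p False @ ?O2"
  let ?O4 = "replicate (q * n) True @ ?O3"
  let ?O5 = "replicate r True @ ?O4"
  let ?O6 = "False # ?O5"
  let ?O7 = "replicate l True @ ?O6"
  show "reach m (emit 3 18 False) (?L Out W) (?L ?O1 W)"
    by (rule reach_emit[where x = q]) (use assms in \<open>auto simp: layout_def fun_eq_iff\<close>)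
  show "reach m (IfThenElse (Nonempty 17) (Seq (Pop 17) (Push 14 True)) (Push 14 False))
      (?L ?O1 W) (?L ?O2 (W - 1))"
    by (intro step; cases W) (auto simp: layout_def fun_eq_iff)
  show "reach m (emit 2 18 False) (?L ?O2 (W - 1)) (?L ?O3 (W - 1))"
    by (rule reach_emit[where x = p]) (use assms in \<open>auto simp: layout_def fun_eq_iff\<close>)
  show "reach m (blocks 3 True) (?L ?O3 (W - 1)) (?L ?O4 (W - 1))"
    by (rule reach_blocks[where x = q]) (use assms in \<open>auto simp: layout_def fun_eq_iff\<close>)
  show "reach m (emit 7 18 True) (?L ?O4 (W - 1)) (?L ?O5 (W - 1))"
    by (rule reach_emit[where x = r]) (use assms in \<open>auto simp: layout_def fun_eq_iff\<close>)
  show "reach m (Push 14 False) (?L ?O5 (W - 1)) (?L ?O6 (W - 1))"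
    by (intro step) (auto simp: layout_def fun_eq_iff)
  show "reach m (emit 6 18 True) (?L ?O6 (W - 1)) (?L ?O7 (W - 1))"
    by (rule reach_emit[where x = l]) (use assms in \<open>auto simp: layout_def fun_eq_iff\<close>)
  show "reach m (blocks 2 True) (?L ?O7 (W - 1))
    (?L (rev (replicate q False @ [0 < W] @ replicate p False @ replicate (q * n) True @
        replicate r True @ [False] @ replicate l True @ replicate (p * n) True) @ Out) (W - 1))"
    by (rule reach_blocks[where x = p]) (use assms in \<open>auto simp: layout_def fun_eq_iff\<close>)
qed

definition pad_rows :: prog where
  "pad_rows = Seq load (Seq (scan (Pop 17) Skip) (rep 6 7 pad_row))"

definition pad_line :: "nat \<Rightarrow> nat \<Rightarrow> nat \<Rightarrow> nat \<Rightarrow> bool list" where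
  "pad_line n w i l = replicate i False @ [l < w] @ replicate (n - Suc i) False @
     replicate (i * n) True @ replicate l True @ [False] @ replicate (n - Suc l) True @
     replicate ((n - Suc i) * n) True"

lemma reach_pad_rows:
  assumes "length xs = n" "n \<le> m" "D \<le> n" "i < n"
  shows "reach m pad_rows (layout n k (xs @ ys) (n - Suc i) i n 0 B Out D 0)
    (layout n k ys (n - Suc i) i n 0 (rev xs @ B)
      (rev (concat (map (pad_line n (D - count_true xs n) i) [0..<n])) @ Out) D 0)"
  unfolding pad_rows_def
proof (rule reach_Seq[OF reach_load reach_Seq])
  let ?p = "n - Suc i"
  let ?S = "\<lambda>j. layout n k [] ?p i n 0 [] Out D (D - count_true xs j)"
  let ?w = "D - count_true xs n"
  show "reach m (scan (Pop 17) Skip) (layout n k (xs @ ys) ?p i n 0 B Out D D)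
    (layout n k ys ?p i n 0 (rev xs @ B) Out D ?w)"
  proof (rule reach_scan[where S = ?S])
    fix j C B' a b assume j: "j < n"
    have d: "tl (unary (D - count_true xs j)) = unary (D - Suc (count_true xs j))"
      by (cases "D - count_true xs j") (auto simp flip: diff_Suc_eq_diff_pred)
    show "reach m (if xs ! j then Pop 17 else Skip)
      ((?S j)(0 := C, 13 := B', 4 := a, 5 := b)) ((?S (Suc j))(0 := C, 13 := B', 4 := a, 5 := b))"
      by (cases "xs ! j"; simp only: if_True if_False; intro step)
        (auto simp: layout_def fun_eq_iff d)
  qed (use assms in \<open>auto simp: layout_def fun_eq_iff\<close>)
  let ?P = "\<lambda>j. concat (map (pad_line n ?w i) [0..<j])"
  have w: "?w \<le> n" using assms by simp
  show "reach m (rep 6 7 pad_row) (layout n k ys ?p i n 0 (rev xs @ B) Out D ?w)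
    (layout n k ys ?p i n 0 (rev xs @ B) (rev (?P n) @ Out) D 0)"
  proof (rule reach_rep[where S = "\<lambda>j. layout n k ys ?p i n 0 (rev xs @ B) (rev (?P j) @ Out) D (?w - j)"])
    fix j assume j: "j < n"
    have u: "(layout n k ys ?p i n 0 (rev xs @ B) O' D W)(6 := unary (n - Suc j), 7 := unary j) =
       layout n k ys ?p i (n - Suc j) j (rev xs @ B) O' D W" for O' W
      by (auto simp: layout_def fun_eq_iff)
    show "reach m pad_row
      ((layout n k ys ?p i n 0 (rev xs @ B) (rev (?P j) @ Out) D (?w - j))(6 := unary (n - Suc j), 7 := unary j))
      ((layout n k ys ?p i n 0 (rev xs @ B) (rev (?P (Suc j)) @ Out) D (?w - Suc j))
        (6 := unary (n - Suc j), 7 := unary j))"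
      unfolding u by (rule reach_eq[OF reach_pad_row]) (use assms j in \<open>auto simp: pad_line_def less_diff_conv add.commute\<close>)
  qed (use assms w in \<open>auto simp: layout_def fun_eq_iff\<close>)
qed (use assms in simp)

definition row_pass :: "prog \<Rightarrow> prog" where
  "row_pass c = Seq (rep 2 3 c) (move 13 0)"

lemma reach_row_pass:
  assumes len: "n \<le> m" "length (concat (map R [0..<n])) \<le> m"
    and row: "\<And>i ys B. i < n \<Longrightarrow> reach m c (layout n k (R i @ ys) (n - Suc i) i n 0 B (Out i) (D i) 0)
      (layout n k ys (n - Suc i) i n 0 (rev (R i) @ B) (Out (Suc i)) (D (Suc i)) 0)"
  shows "reach m (row_pass c) (layout n k (concat (map R [0..<n])) n 0 n 0 [] (Out 0) (D 0) 0)
    (layout n k (concat (map R [0..<n])) n 0 n 0 [] (Out n) (D n) 0)"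
  unfolding row_pass_def
proof (rule reach_Seq)
  let ?A = "concat (map R [0..<n])"
  let ?S = "\<lambda>i. layout n k (concat (map R [i..<n])) n 0 n 0 (rev (concat (map R [0..<i]))) (Out i) (D i) 0"
  show "reach m (rep 2 3 c) (layout n k ?A n 0 n 0 [] (Out 0) (D 0) 0)
    (layout n k [] n 0 n 0 (rev ?A) (Out n) (D n) 0)"
  proof (rule reach_rep[where S = ?S])
    fix i assume i: "i < n"
    have u: "(layout n k A n 0 n 0 B O' D' 0)(2 := unary (n - Suc i), 3 := unary i) =
       layout n k A (n - Suc i) i n 0 B O' D' 0" for A B O' D'
      by (auto simp: layout_def fun_eq_iff)
    show "reach m c ((?S i)(2 := unary (n - Suc i), 3 := unary i))
      ((?S (Suc i))(2 := unary (n - Suc i), 3 := unary i))"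
      unfolding u using row[OF i] i by (simp add: upt_conv_Cons)
  qed (use len in \<open>auto simp: layout_def fun_eq_iff\<close>)
  show "reach m (move 13 0) (layout n k [] n 0 n 0 (rev ?A) (Out n) (D n) 0)
    (layout n k ?A n 0 n 0 [] (Out n) (D n) 0)"
    by (rule reach_move) (use len in \<open>auto simp: layout_def fun_eq_iff\<close>)
qed

definition parse :: prog where
  "parse = Seq (While (TopTrue 0) (Seq (Pop 0) (Seq (Push 2 True) (Seq (Push 4 True) (Push 6 True)))))
     (Seq (Pop 0) (Seq (While (TopTrue 0) (Seq (Pop 0) (Push 10 True))) (Pop 0)))"

lemma reach_parse:
  assumes "n \<le> m" "k \<le> m"
  shows "reach m parse (initial (unary n @ False # unary k @ False # A)) (layout n k A n 0 n 0 [] [] 0 0)"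
  unfolding parse_def
proof (rule reach_Seq[OF _ seq_pop[OF reach_Seq]])
  define S where "S i = (\<lambda>_::nat. [])(0 := unary (n - i) @ False # unary k @ False # A,
     2 := unary i, 4 := unary i, 6 := unary i)" for i
  have "reach m (While (TopTrue 0) (Seq (Pop 0) (Seq (Push 2 True) (Seq (Push 4 True) (Push 6 True))))) (S 0) (S n)"
  proof (rule reach_While)
    fix i assume "i < n"
    then have "n - i = Suc (n - Suc i)" by simp
    then show "holds (TopTrue 0) (S i)"
      "reach m (Seq (Pop 0) (Seq (Push 2 True) (Seq (Push 4 True) (Push 6 True)))) (S i) (S (Suc i))"
      by (simp add: S_def, intro step) (auto simp: S_def fun_eq_iff)
  qed (use assms in \<open>auto simp: S_def\<close>)
  moreover have "S 0 = initial (unary n @ False # unary k @ False # A)"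
    by (auto simp: S_def initial_def fun_eq_iff)
  ultimately show "reach m (While (TopTrue 0) (Seq (Pop 0) (Seq (Push 2 True) (Seq (Push 4 True) (Push 6 True)))))
    (initial (unary n @ False # unary k @ False # A)) (S n)" by simp
  define R where "R i = (\<lambda>_::nat. [])(0 := unary (k - i) @ False # A,
     2 := unary n, 4 := unary n, 6 := unary n, 10 := unary i)" for i
  have "reach m (While (TopTrue 0) (Seq (Pop 0) (Push 10 True))) (R 0) (R k)"
  proof (rule reach_While)
    fix i assume "i < k"
    then have "k - i = Suc (k - Suc i)" by simp
    then show "holds (TopTrue 0) (R i)" "reach m (Seq (Pop 0) (Push 10 True)) (R i) (R (Suc i))"
      by (simp add: R_def, intro step) (auto simp: R_def fun_eq_iff)
  qed (use assms in \<open>auto simp: R_def\<close>)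
  moreover have "(S n)(0 := tl (S n 0)) = R 0" by (auto simp: S_def R_def fun_eq_iff)
  ultimately show "reach m (While (TopTrue 0) (Seq (Pop 0) (Push 10 True))) ((S n)(0 := tl (S n 0))) (R k)"
    by simp
  show "reach m (Pop 0) (R k) (layout n k A n 0 n 0 [] [] 0 0)"
    by (intro step) (auto simp: R_def layout_def fun_eq_iff)
qed

definition header :: prog where
  "header = Seq (rep 2 3 (Seq (Push 14 True) (emit 4 5 True)))
     (Seq (Push 14 False) (Seq (emit 10 11 True) (Push 14 False)))"

lemma reach_header:
  assumes "n \<le> m" "k \<le> m"
  shows "reach m header (layout n k A n 0 n 0 [] [] 0 0)
    (layout n k A n 0 n 0 [] (rev (unary (n + n * n) @ [False] @ unary k @ [False])) 0 0)"
  unfolding header_def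
proof (rule reach_Seq[OF _ seq_push[OF reach_Seq]])
  let ?S = "\<lambda>i. layout n k A n 0 n 0 [] (unary (i + i * n)) 0 0"
  show "reach m (rep 2 3 (Seq (Push 14 True) (emit 4 5 True))) (layout n k A n 0 n 0 [] [] 0 0) (?S n)"
  proof (rule reach_rep[where S = ?S])
    fix i assume "i < n"
    have e: "Suc i + Suc i * n = n + Suc (i + i * n)" by simp
    show "reach m (Seq (Push 14 True) (emit 4 5 True)) ((?S i)(2 := unary (n - Suc i), 3 := unary i))
      ((?S (Suc i))(2 := unary (n - Suc i), 3 := unary i))"
      unfolding e
      by (rule seq_push, rule reach_emit[where x = n])
        (use assms in \<open>auto simp: layout_def fun_eq_iff replicate_add replicate_append_same\<close>)
  qed (use assms in \<open>auto simp: layout_def fun_eq_iff\<close>)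
  let ?u = "(?S n)(14 := False # ?S n 14)"
  show "reach m (emit 10 11 True) ?u (?u(14 := unary k @ ?u 14))"
    by (rule reach_emit) (use assms in auto)
  show "reach m (Push 14 False) (?u(14 := unary k @ ?u 14))
    (layout n k A n 0 n 0 [] (rev (unary (n + n * n) @ [False] @ unary k @ [False])) 0 0)"
    by (intro step) (auto simp: layout_def fun_eq_iff)
qed

definition old_line :: "nat \<Rightarrow> bool list \<Rightarrow> nat \<Rightarrow> nat \<Rightarrow> bool list" where
  "old_line n xs w i = xs @ replicate (i * n) False @ map (\<lambda>l. l < w) [0..<n] @
     replicate ((n - Suc i) * n) False"

definition construct :: prog where
  "construct = Seq parse (Seq header (Seq (row_pass max_row) (Seq (row_pass old_row)
     (Seq (row_pass pad_rows) (Seq (clear 0) (move 14 0))))))"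

lemma reach_construct:
  fixes R :: "nat \<Rightarrow> bool list" and n k m :: nat
  defines "D \<equiv> Max (insert 0 ((\<lambda>i. count_true (R i) n) ` {..<n}))"
  defines "w \<equiv> \<lambda>i. D - count_true (R i) n"
  defines "code \<equiv> unary (n + n * n) @ [False] @ unary k @ [False] @
      concat (map (\<lambda>i. old_line n (R i) (w i) i) [0..<n]) @
      concat (map (\<lambda>i. concat (map (pad_line n (w i) i) [0..<n])) [0..<n])"
  assumes R: "\<And>i. i < n \<Longrightarrow> length (R i) = n"
    and m: "length code \<le> m"
  shows "reach m construct (initial (unary n @ [False] @ unary k @ [False] @ concat (map R [0..<n])))
    (layout n k code n 0 n 0 [] [] D 0)"
proof -
  have le: "n \<le> m" "k \<le> m" using m by (auto simp: code_def)
  have A: "length (concat (map R [0..<n])) \<le> m"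
  proof -
    have "length (concat (map R [0..<n])) = sum_list (map (\<lambda>_. n) [0..<n])"
      unfolding length_concat map_map using R by (intro arg_cong[where f = sum_list] map_cong) auto
    also have "\<dots> = n * n" by (simp add: sum_list_triv)
    also have "\<dots> \<le> m" using m by (simp add: code_def)
    finally show ?thesis .
  qed
  let ?A = "concat (map R [0..<n])"
  let ?D = "\<lambda>i. Max (insert 0 ((\<lambda>i. count_true (R i) n) ` {..<i}))"
  have Dle: "?D i \<le> n" for i by (subst Max_le_iff) (auto intro: count_true_le)
  let ?L = "\<lambda>A Y D. layout n k A n 0 n 0 [] Y D 0"
  let ?O1 = "rev (unary (n + n * n) @ [False] @ unary k @ [False])"
  let ?O2 = "\<lambda>i. rev (concat (map (\<lambda>i. old_line n (R i) (w i) i) [0..<i])) @ ?O1"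
  let ?O3 = "\<lambda>i. rev (concat (map (\<lambda>i. concat (map (pad_line n (w i) i) [0..<n])) [0..<i])) @ ?O2 n"
  have 1: "reach m parse (initial (unary n @ [False] @ unary k @ [False] @ ?A)) (?L ?A [] 0)"
    using reach_parse[OF le] by simp
  have 2: "reach m header (?L ?A [] 0) (?L ?A ?O1 0)"
    by (rule reach_header[OF le])
  have "reach m (row_pass max_row) (?L ?A ?O1 (?D 0)) (?L ?A ?O1 (?D n))"
  proof (rule reach_row_pass[OF le(1) A])
    fix i ys B assume i: "i < n"
    have "?D (Suc i) = max (?D i) (count_true (R i) n)"
    proof -
      have "insert 0 ((\<lambda>i. count_true (R i) n) ` {..<Suc i}) =
        insert (count_true (R i) n) (insert 0 ((\<lambda>i. count_true (R i) n) ` {..<i}))"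
        by (auto simp: lessThan_Suc)
      then show ?thesis by (simp only: Max_insert finite_insert finite_imageI finite_lessThan insert_not_empty
        not_False_eq_True max.commute)
    qed
    then show "reach m max_row (layout n k (R i @ ys) (n - Suc i) i n 0 B ?O1 (?D i) 0)
      (layout n k ys (n - Suc i) i n 0 (rev (R i) @ B) ?O1 (?D (Suc i)) 0)"
      using reach_max_row[OF R[OF i] le(1) Dle[of i]] by (simp del: rev_append)
  qed
  then have 3: "reach m (row_pass max_row) (?L ?A ?O1 0) (?L ?A ?O1 D)" by (simp add: D_def)
  have "reach m (row_pass old_row) (?L ?A (?O2 0) D) (?L ?A (?O2 n) D)"
  proof (rule reach_row_pass[OF le(1) A])
    fix i ys B assume i: "i < n"
    show "reach m old_row (layout n k (R i @ ys) (n - Suc i) i n 0 B (?O2 i) D 0)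
      (layout n k ys (n - Suc i) i n 0 (rev (R i) @ B) (?O2 (Suc i)) D 0)"
      by (rule reach_eq[OF reach_old_row[OF R[OF i]]])
        (use le i Dle in \<open>auto simp: D_def w_def old_line_def\<close>)
  qed
  then have 4: "reach m (row_pass old_row) (?L ?A ?O1 D) (?L ?A (?O2 n) D)" by simp
  have "reach m (row_pass pad_rows) (?L ?A (?O3 0) D) (?L ?A (?O3 n) D)"
  proof (rule reach_row_pass[OF le(1) A])
    fix i ys B assume i: "i < n"
    show "reach m pad_rows (layout n k (R i @ ys) (n - Suc i) i n 0 B (?O3 i) D 0)
      (layout n k ys (n - Suc i) i n 0 (rev (R i) @ B) (?O3 (Suc i)) D 0)"
      by (rule reach_eq[OF reach_pad_rows[OF R[OF i]]])
        (use le i Dle in \<open>auto simp: D_def w_def\<close>)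
  qed
  then have 5: "reach m (row_pass pad_rows) (?L ?A (?O2 n) D) (?L ?A (?O3 n) D)" by simp
  have code: "?O3 n = rev code" by (simp add: code_def)
  have 6: "reach m (clear 0) (?L ?A (?O3 n) D) (?L [] (rev code) D)"
    unfolding code by (rule reach_clear) (use A in \<open>auto simp: layout_def fun_eq_iff\<close>)
  have 7: "reach m (move 14 0) (?L [] (rev code) D) (?L code [] D)"
    by (rule reach_move) (use m in \<open>auto simp: layout_def fun_eq_iff\<close>)
  show ?thesis unfolding construct_def
    by (rule reach_Seq[OF 1 reach_Seq[OF 2 reach_Seq[OF 3 reach_Seq[OF 4 reach_Seq[OF 5 reach_Seq[OF 6 7]]]]]])
qed

lemma map_if_eq_upt:
  "i < n \<Longrightarrow> map (\<lambda>j. if j = i then a else b) [0..<n] = replicate i b @ [a] @ replicate (n - Suc i) b"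
  by (rule nth_equalityI) (auto simp: nth_append nth_Cons' not_less)

lemma concat_replicate_replicate: "concat (replicate x (replicate n b)) = replicate (x * n) b"
  by (induction x) (auto simp: replicate_add)

lemma map_upt_add: "map f [0..<a + b] = map f [0..<a] @ map (\<lambda>y. f (a + y)) [0..<b]"
  by (rule nth_equalityI) (auto simp: nth_append)

lemma map_upt_mult:
  "map f [0..<m * n] = concat (map (\<lambda>i. map (\<lambda>l. f (i * n + l)) [0..<n]) [0..<m])"
proof (induction m)
  case (Suc m)
  have "map f [0..<Suc m * n] = map f [0..<m * n + n]" by (simp add: add.commute)
  also have "\<dots> = map f [0..<m * n] @ map (\<lambda>l. f (m * n + l)) [0..<n]" by (rule map_upt_add)
  finally show ?case using Suc by simp
qed simp

definition row :: "nat \<Rightarrow> nat set set \<Rightarrow> nat \<Rightarrow> bool list" where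
  "row n E i = map (\<lambda>j. {i, j} \<in> E) [0..<n]"

lemma count_true_row:
  assumes "simple_graph n E"
  shows "count_true (row n E i) n = vertex_degree E i"
  unfolding vertex_degree_eq_card_nbrs[OF assms] count_true_def
  by (rule arg_cong[where f = card]) (auto simp: row_def)

lemma row_regularize_old:
  assumes simple: "simple_graph n E" and i: "i < n"
  shows "row (n + n * n) (regularize n E) i =
    old_line n (row n E i) (max_degree n E - vertex_degree E i) i"
proof -
  let ?w = "max_degree n E - vertex_degree E i"
  have "map (\<lambda>y. {i, n + y} \<in> regularize n E) [0..<n * n] =
      concat (map (\<lambda>j. map (\<lambda>l. {i, n + (j * n + l)} \<in> regularize n E) [0..<n]) [0..<n])"
    by (rule map_upt_mult)
  also have "map (\<lambda>j. map (\<lambda>l. {i, n + (j * n + l)} \<in> regularize n E) [0..<n]) [0..<n] =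
      map (\<lambda>j. if j = i then map (\<lambda>l. l < ?w) [0..<n] else replicate n False) [0..<n]"
    using i by (intro map_cong refl) (auto simp: regularize_cross[OF simple] intro!: nth_equalityI)
  finally show ?thesis using i
    by (simp add: row_def map_upt_add map_if_eq_upt concat_replicate_replicate old_line_def
        regularize_old[OF simple] cong: map_cong)
qed

lemma row_regularize_pad:
  assumes simple: "simple_graph n E" and i: "i < n" and l: "l < n"
  shows "row (n + n * n) (regularize n E) (n + (i * n + l)) =
    pad_line n (max_degree n E - vertex_degree E i) i l"
proof -
  let ?w = "max_degree n E - vertex_degree E i" and ?y = "i * n + l"
  have y: "?y < n * n" using i l by (rule block_less)
  have 1: "map (\<lambda>j. {n + ?y, j} \<in> regularize n E) [0..<n] = map (\<lambda>j. if j = i then l < ?w else False) [0..<n]"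
    using i l by (intro map_cong refl)
      (auto simp: regularize_cross[OF simple] insert_commute[of "n + (i * n + l)"])
  have 2: "map (\<lambda>z. {n + ?y, n + z} \<in> regularize n E) [0..<n * n] =
      map (\<lambda>z. if z = ?y then False else True) [0..<n * n]"
    using y by (intro map_cong refl) (auto simp: regularize_clique[OF simple])
  have "n * n = (i + 1 + (n - Suc i)) * n" using i by simp
  then have "n * n - Suc ?y = (n - Suc l) + (n - Suc i) * n"
    using l unfolding add_mult_distrib by linarith
  then show ?thesis
    unfolding row_def map_upt_add 1 2 map_if_eq_upt[OF i] map_if_eq_upt[OF y] pad_line_def
    by (simp add: replicate_add)
qed

lemma encode_row:
  "encode (n, E, k) = unary n @ [False] @ unary k @ [False] @ concat (map (row n E) [0..<n])"
  by (simp add: encode_def row_def[abs_def])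

lemma encode_regularize:
  assumes simple: "simple_graph n E"
  defines "w \<equiv> \<lambda>i. max_degree n E - vertex_degree E i"
  shows "encode (n + n * n, regularize n E, k) = unary (n + n * n) @ [False] @ unary k @ [False] @
      concat (map (\<lambda>i. old_line n (row n E i) (w i) i) [0..<n]) @
      concat (map (\<lambda>i. concat (map (pad_line n (w i) i) [0..<n])) [0..<n])"
proof -
  let ?r = "row (n + n * n) (regularize n E)"
  have 1: "map ?r [0..<n] = map (\<lambda>i. old_line n (row n E i) (w i) i) [0..<n]"
    by (intro map_cong refl) (simp add: row_regularize_old[OF simple] w_def)
  have 2: "map (\<lambda>i. map (\<lambda>l. ?r (n + (i * n + l))) [0..<n]) [0..<n] =
      map (\<lambda>i. map (pad_line n (w i) i) [0..<n]) [0..<n]"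
    by (intro map_cong refl) (simp add: row_regularize_pad[OF simple] w_def)
  have 3: "concat (concat (map f xs)) = concat (map (\<lambda>i. concat (f i)) xs)" for f :: "nat \<Rightarrow> bool list list" and xs
    by (induction xs) auto
  show ?thesis
    unfolding encode_row map_upt_add concat_append map_upt_mult 1 2 3 ..
qed

lemma reach_construct_encode:
  assumes simple: "simple_graph n E" and m: "length (encode (n + n * n, regularize n E, k)) \<le> m"
  shows "reach m construct (initial (encode (n, E, k)))
    (layout n k (encode (n + n * n, regularize n E, k)) n 0 n 0 [] [] (max_degree n E) 0)"
proof -
  have "Max (insert 0 ((\<lambda>i. count_true (row n E i) n) ` {..<n})) = max_degree n E"
    by (simp add: max_degree_def count_true_row[OF simple])
  then show ?thesis
    using reach_construct[of n "row n E" k m] m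
    unfolding encode_row[of n] encode_regularize[OF simple] count_true_row[OF simple]
    by (simp add: row_def)
qed

lemma length_encode: "length (encode (n, E, k)) = n + k + 2 + n * n"
  by (simp add: encode_def length_concat comp_def sum_list_triv)

section \<open>The reduction\<close>

definition trim :: "nat \<Rightarrow> nat \<Rightarrow> bool list \<Rightarrow> bool list" where
  "trim n k y = map (\<lambda>i. y ! i \<and> count_true y i < k) [0..<n]"

lemma card_trim: "card {i. i < n \<and> y ! i \<and> count_true y i < k} = min k (count_true y n)"
proof (induction n)
  case (Suc n)
  have "{i. i < Suc n \<and> y ! i \<and> count_true y i < k} =
    (if y ! n \<and> count_true y n < k then insert n {i. i < n \<and> y ! i \<and> count_true y i < k}
     else {i. i < n \<and> y ! i \<and> count_true y i < k})"
    by (auto simp: less_Suc_eq)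
  then show ?case using Suc by auto
qed simp

lemma decode_trim: "decode_set (trim n k y) = {i. i < n \<and> y ! i \<and> count_true y i < k}"
  by (auto simp: decode_set_def trim_def)

definition postprocess :: prog where
  "postprocess = Seq (rep 2 3 (Seq (IfThenElse (TopTrue 0)
       (IfThenElse (Nonempty 10) (Seq (Pop 10) (Push 14 True)) (Push 14 False)) (Push 14 False)) (Pop 0)))
     (Seq (clear 0) (move 14 0))"

lemma reach_postprocess:
  assumes "s 0 = y" "n \<le> length y" "length y \<le> m" "s 2 = unary n" "s 3 = []" "s 10 = unary k" "s 14 = []"
  obtains s' where "reach m postprocess s s'" "s' 0 = trim n k y"
proof -
  define S where "S i = s(0 := drop i y, 10 := unary (k - count_true y i), 14 := rev (trim i k y))" for i
  let ?c = "Seq (IfThenElse (TopTrue 0)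
       (IfThenElse (Nonempty 10) (Seq (Pop 10) (Push 14 True)) (Push 14 False)) (Push 14 False)) (Pop 0)"
  have 1: "reach m (rep 2 3 ?c) s ((S n)(2 := unary n, 3 := []))"
  proof (rule reach_rep[where S = S])
    fix i assume i: "i < n"
    then have d: "drop i y = y ! i # drop (Suc i) y" using assms by (simp add: Cons_nth_drop_Suc)
    show "reach m ?c ((S i)(2 := unary (n - Suc i), 3 := unary i))
      ((S (Suc i))(2 := unary (n - Suc i), 3 := unary i))"
    proof (cases "count_true y i < k")
      case True
      then have "k - count_true y i = Suc (k - Suc (count_true y i))" by simp
      with True d show ?thesis
        by (intro step) (auto simp: S_def trim_def fun_eq_iff)
    next
      case False
      then have "k - count_true y i = 0" "k - Suc (count_true y i) = 0" by simp_all
      with False d show ?thesis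
        by (intro step) (auto simp: S_def trim_def fun_eq_iff)
    qed
  qed (use assms in \<open>auto simp: S_def trim_def fun_eq_iff\<close>)
  let ?u = "(S n)(2 := unary n, 3 := [])"
  have 2: "reach m (clear 0) ?u (?u(0 := []))"
    by (rule reach_clear) (use assms in \<open>auto simp: S_def\<close>)
  have 3: "reach m (move 14 0) (?u(0 := [])) (?u(0 := [], 14 := [], 0 := trim n k y))"
    by (rule reach_move) (use assms in \<open>auto simp: S_def fun_eq_iff trim_def\<close>)
  show thesis
    by (rule that[OF reach_Seq[OF 1 reach_Seq[OF 2 3], folded postprocess_def]]) simp
qed

text \<open>Shifting the registers of the given program keeps \<open>n\<close> and \<open>k\<close> safe and hides the leftovers of the
  construction from it.\<close>

definition shift :: "nat \<Rightarrow> nat" where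
  "shift r = (if r = 0 then 0 else r + 20)"

definition reduction :: "prog \<Rightarrow> prog" where
  "reduction c = Seq construct (Seq (rename shift c) postprocess)"

lemma runs_reduction:
  assumes simple: "simple_graph n E"
    and run: "runs c (initial (encode (n + n * n, regularize n E, k))) t s"
    and len: "length (s 0) = n + n * n"
  defines "m \<equiv> length (encode (n + n * n, regularize n E, k))"
  obtains t' s' where "runs (reduction c) (initial (encode (n, E, k))) t' s'"
    "t' \<le> time_bound construct m + (t + time_bound postprocess m)" "s' 0 = trim n k (s 0)"
proof -
  let ?x = "encode (n + n * n, regularize n E, k)"
  let ?u = "layout n k ?x n 0 n 0 [] [] (max_degree n E) 0"
  obtain t1 where t1: "runs construct (initial (encode (n, E, k))) t1 ?u" "t1 \<le> time_bound construct m"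
    using reach_construct_encode[OF simple, of k m] unfolding reach_def m_def by auto
  have "inj shift" by (auto simp: shift_def inj_def split: if_splits)
  moreover have "?u (shift r) = initial ?x r" for r
    by (auto simp: shift_def layout_def initial_def)
  ultimately obtain v where v: "runs (rename shift c) ?u t v" "\<forall>r. v (shift r) = s r"
      "\<forall>q. q \<notin> range shift \<longrightarrow> v q = ?u q"
    using runs_rename run by blast
  have v0: "v 0 = s 0" using v(2)[rule_format, of 0] by (simp add: shift_def)
  have low: "v q = ?u q" if "0 < q" "q \<le> 20" for q
    using v(3) that by (auto simp: shift_def split: if_splits)
  obtain s' where s': "reach m postprocess v s'" "s' 0 = trim n k (s 0)"
    by (rule reach_postprocess[of v "s 0" n m k])
      (use v0 len low in \<open>auto simp: m_def length_encode\<close>)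
  then obtain t2 where t2: "runs postprocess v t2 s'" "t2 \<le> time_bound postprocess m"
    unfolding reach_def by blast
  have "runs (reduction c) (initial (encode (n, E, k))) (t1 + (t + t2)) s'"
    unfolding reduction_def by (rule runs.Seq[OF t1(1) runs.Seq[OF v(1) t2(1)]])
  then show thesis by (rule that) (use t1 t2 s' in auto)
qed

lemma solves_reduction:
  assumes c: "solves_in_poly_time encode c instances (fcec_approx \<rho>)"
    and F: "F \<subseteq> instances"
    and ok: "\<And>n E k y. (n, E, k) \<in> F \<Longrightarrow> fcec_approx \<rho> (n + n * n, regularize n E, k) y \<Longrightarrow>
      ok (n, E, k) (trim n k y)"
  shows "solves_in_poly_time encode (reduction c) F ok"
proof -
  obtain q where q: "\<And>i. i \<in> instances \<Longrightarrow> \<exists>t s. runs c (initial (encode i)) t s \<and>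
      t \<le> poly q (length (encode i)) \<and> fcec_approx \<rho> i (s 0)"
    using c unfolding solves_in_poly_time_def by blast
  obtain p1 where p1: "\<And>m. time_bound construct m = poly p1 m" using time_bound_poly by blast
  obtain p2 where p2: "\<And>m. time_bound postprocess m = poly p2 m" using time_bound_poly by blast
  define X :: "nat poly" where "X = [:0, 1:]"
  define M where "M = (X + X * X) + X + 2 + (X + X * X) * (X + X * X)"
  define P where "P = pcompose (p1 + (q + p2)) M"
  show ?thesis unfolding solves_in_poly_time_def
  proof (intro exI[of _ P] ballI)
    fix i assume i: "i \<in> F"
    obtain n E k where nEk: "i = (n, E, k)" by (cases i)
    then have simple: "simple_graph n E" and k: "k \<le> n" using i F by (auto simp: instances_def)
    let ?i' = "(n + n * n, regularize n E, k)"
    have "?i' \<in> instances" using simple_regularize[OF simple] k by (simp add: instances_def)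
    then obtain t s where ts: "runs c (initial (encode ?i')) t s" "t \<le> poly q (length (encode ?i'))"
        "fcec_approx \<rho> ?i' (s 0)"
      using q by blast
    have "length (s 0) = n + n * n" using ts(3) by (simp add: fcec_approx_def)
    then obtain t' s' where t': "runs (reduction c) (initial (encode i)) t' s'"
        "t' \<le> time_bound construct (length (encode ?i')) + (t + time_bound postprocess (length (encode ?i')))"
        "s' 0 = trim n k (s 0)"
      using runs_reduction[OF simple ts(1)] nEk by metis
    let ?N = "length (encode i)"
    have N: "n \<le> ?N" "k \<le> ?N" by (simp_all add: nEk length_encode)
    have "t' \<le> poly (p1 + (q + p2)) (length (encode ?i'))"
      using t'(2) ts(2) by (simp add: p1 p2)
    also have "\<dots> \<le> poly (p1 + (q + p2)) (poly M ?N)"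
    proof (rule poly_nat_mono)
      have "poly M ?N = (?N + ?N * ?N) + ?N + 2 + (?N + ?N * ?N) * (?N + ?N * ?N)"
        by (simp add: M_def X_def algebra_simps)
      then show "length (encode ?i') \<le> poly M ?N"
        unfolding length_encode[of "n + n * n"] using N by (simp only: add_mono mult_le_mono order_refl)
    qed
    also have "\<dots> = poly P ?N" by (simp add: P_def poly_pcompose)
    finally show "\<exists>t s. runs (reduction c) (initial (encode i)) t s \<and> t \<le> poly P ?N \<and> ok i (s 0)"
      using t' ok[of n E k "s 0"] ts(3) i nEk by (intro exI[of _ t'] exI[of _ s']) auto
  qed
qed

theorem theorem5p2:
  fixes F :: "inst set"
  assumes "dks_family F"
    and "fcec_has_ptas"
  shows "dks_has_const_approx_on F"
proof -
  have F: "F \<subseteq> instances"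
    and bt1: "(\<lambda>(n, E, k). real k) \<in> \<Theta>[principal F](\<lambda>(n, E, k). real n powr (2/3))"
    and bo: "(\<lambda>(n, E, k). real (max_degree n E)) \<in> O[principal F](\<lambda>(n, E, k). real n powr (1/3))"
    and bt2: "(\<lambda>(n, E, k). real (dks_opt (n, E, k))) \<in> \<Theta>[principal F](\<lambda>(n, E, k). real k * real n powr (1/3))"
    using assms(1) by (auto simp: dks_family_def)
  have "\<exists>c>0. \<forall>n E k. (n, E, k) \<in> F \<longrightarrow> c * real n powr (2/3) \<le> real k"
    using bigthetaD2[OF bt1]
    by (elim landau_omega.bigE) (fastforce simp: eventually_principal)
  then obtain c3 where c3: "c3 > 0" "\<And>n E k. (n, E, k) \<in> F \<Longrightarrow> c3 * real n powr (2/3) \<le> real k"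
    by blast
  have "\<exists>c>0. \<forall>n E k. (n, E, k) \<in> F \<longrightarrow> real (max_degree n E) \<le> c * real n powr (1/3)"
    using bo by (elim landau_o.bigE) (fastforce simp: eventually_principal)
  then obtain c2 where c2: "c2 > 0"
      "\<And>n E k. (n, E, k) \<in> F \<Longrightarrow> real (max_degree n E) \<le> c2 * real n powr (1/3)"
    by blast
  have "\<exists>c>0. \<forall>n E k. (n, E, k) \<in> F \<longrightarrow> c * (real k * real n powr (1/3)) \<le> real (dks_opt (n, E, k))"
    using bigthetaD2[OF bt2]
    by (elim landau_omega.bigE) (fastforce simp: eventually_principal abs_mult)
  then obtain c1 where c1: "c1 > 0"
      "\<And>n E k. (n, E, k) \<in> F \<Longrightarrow> c1 * (real k * real n powr (1/3)) \<le> real (dks_opt (n, E, k))"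
    by blast
  define \<epsilon> where "\<epsilon> = c1 / (2 * c2)"
  have eps: "\<epsilon> > 0" using c1 c2 by (simp add: \<epsilon>_def)
  obtain c where c: "solves_in_poly_time encode c instances (fcec_approx (1 + \<epsilon>))"
    using assms(2) eps unfolding fcec_has_ptas_def by blast
  have "solves_in_poly_time encode (reduction c) F (dks_approx 2)"
  proof (rule solves_reduction[OF c F])
    fix n E k y
    assume i: "(n, E, k) \<in> F" and y: "fcec_approx (1 + \<epsilon>) (n + n * n, regularize n E, k) y"
    have simple: "simple_graph n E" and kn: "k \<le> n" using i F by (auto simp: instances_def)
    show "dks_approx 2 (n, E, k) (trim n k y)"
    proof (cases "n = 0")
      case True
      then have "dks_opt (n, E, k) = edges_inside E {}" using kn by (auto simp: dks_opt_def)
      then show ?thesis using True kn by (auto simp: dks_approx_def trim_def decode_set_def)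
    next
      case False
      then have "0 < c3 * real n powr (2/3)" using c3(1) by simp
      then have k: "0 < k" using c3(2)[OF i] by simp
      then have "0 < c1 * (real k * real n powr (1/3))" using c1(1) False by simp
      then have pos: "0 < dks_opt (n, E, k)" using c1(2)[OF i] by simp
      have "2 * \<epsilon> * (real k * real (max_degree n E)) \<le> 2 * \<epsilon> * (real k * (c2 * real n powr (1/3)))"
        using eps c2(2)[OF i] by (intro mult_left_mono) auto
      also have "\<dots> = c1 * (real k * real n powr (1/3))" using c2(1) by (simp add: \<epsilon>_def)
      also have "\<dots> \<le> real (dks_opt (n, E, k))" by (rule c1(2)[OF i])
      finally have e: "2 * \<epsilon> * (real k * real (max_degree n E)) \<le> real (dks_opt (n, E, k))" .
      note transfer = approx_transfer[OF simple k kn eps e pos y]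
      have "card (decode_set (trim n k y)) = k"
        using transfer(1)[folded count_true_def] by (simp add: decode_trim card_trim)
      moreover have "decode_set (trim n k y) \<subseteq> {v. v < n \<and> y ! v}" by (auto simp: decode_trim)
      moreover have "length (trim n k y) = n" by (simp add: trim_def)
      ultimately show ?thesis using transfer(2) by (simp add: dks_approx_def)
    qed
  qed
  then show ?thesis unfolding dks_has_const_approx_on_def by (intro exI[of _ 2]) auto
qed

end
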